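(* Let $F$ be a $d$-dimensional distribution with density $f$, copula $C$ with density $c$, and margins $F_1,\dots,F_d$ with continuous densities $f_1,\dots,f_d$, satisfying the standing assumptions listed in the context (right-tail equivalence with constants $a_1=1,a_2,\dots,a_d\in(0,\infty)$, and Gumbel-type margins with common self-neglecting auxiliary function $m$). Then the following two conditions are equivalent: (a) for some $\kappa_U\ge1$ and some function $\ell$ slowly varying at $0$, the limit $$\lambda_U(\boldsymbol w;\kappa_U)=\lim_{u\to0^+}\frac{c(1-uw_1,\dots,1-uw_d)}{u^{\kappa_U-d}\ell(u)}>0$$ holds locally uniformly in $\boldsymbol w\in(0,\infty)^d$; (b) for some $\kappa_U>0$ and some $V\in\Gamma_{-1}(m)$, the limit $$\lambda(\boldsymbol x)=\lim_{t\to\infty}\frac{f(t+m(t)x_1,\dots,t+m(t)x_d)}{m^{-d}(t)V^{\kappa_U}(t)}>0$$ holds locally uniformly in $\boldsymbol x\in\mathbb{R}^d$. If either of these two conditions holds, then (with the same $\kappa_U$ and with scaling functions related by $V(t)=\overline F_1(t)[\ell(\overline F_1(t))]^{1/\kappa_U}$), for every $\boldsymbol x=(x_1,\dots,x_d)\in\mathbb{R}^d$, $$\lambda(\boldsymbol x)=\Big(\prod_{i=1}^da_i\Big)e^{-\sum_{i=1}^dx_i}\,\lambda_U(a_1e^{-x_1},\dots,a_de^{-x_d};\kappa_U)=\lambda_U(a_1e^{-x_1},\dots,a_de^{-x_d};\kappa_U)\,\big|J(a_1e^{-x_1},\dots,a_de^{-x_d})\big|,$$ where $J(a_1e^{-x_1},\dots,a_de^{-x_d})$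 is the Jacobian determinant of the homeomorphic transform $w_i=a_ie^{-x_i}$, $1\le i\le d$.
   Context: Notation: $g(t)\sim h(t)$ means $g(t)/h(t)\to1$ as $t\to\infty$. "Locally uniformly" means uniformly on compact subsets. $\overline F_i=1-F_i$. A function $\ell$ is slowly varying at $0$ if $\ell(ux)/\ell(u)\to1$ as $u\to0^+$ for all $x>0$; slowly varying functions are taken to be continuous. A positive measurable function $m$ is self-neglecting if $m(t+m(t)x)/m(t)\to1$ as $t\to\infty$ for $x\in\mathbb{R}$; here $m$ can be taken differentiable with derivative converging to $0$, and then the convergence is locally uniform in $x$. $\Gamma_{-1}(m)$ is the class of measurable functions $V$ with $\lim_{t\to\infty}V(t+m(t)x)/V(t)=e^{-x}$ for all $x\in\mathbb{R}$. Powers: $V^{\kappa_U}(t)=(V(t))^{\kappa_U}$, $m^{-d}(t)=(m(t))^{-d}$. Standing assumptions. (1) Right-tail equivalence: $f_i(t)\sim a_if_1(t)$ as $t\to\infty$, $1\le i\le d$, with constants $0<a_i<\infty$, $a_1=1$. (2) The marginal densities $f_i$ are continuous and $f_i(t+m(t)x)\sim f_i(t)e^{-x}$ as $t\to\infty$ for all $x\in\mathbb{R}$, $1\le i\le d$, where $m$ is a self-neglecting function common to all margins (one may take $m(t)=\overline F_1(t)/f_1(t)$). (3) The copula $C$ of $F$ (the distribution on $[0,1]^d$ with uniform margins such that $F(x_1,\dots,x_d)=C(F_1(x_1),\dots,F_d(x_d))$) has a density $c$ that is continuous in some small open neighborhoods of $\boldsymbol 0$ and of $\boldsymbol 1=(1,\dots,1)$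 (relative to the open cube $(0,1)^d$), and $f(x_1,\dots,x_d)=c(F_1(x_1),\dots,F_d(x_d))\prod_{i=1}^df_i(x_i)$. *)

theory Defs
  imports "HOL-Probability.Probability"
begin

definition has_density :: "'a::euclidean_space measure \<Rightarrow> ('a \<Rightarrow> real) \<Rightarrow> bool" where
  "has_density M f \<longleftrightarrow> f \<in> borel_measurable borel \<and> (\<forall>x. 0 \<le> f x)
     \<and> M = density lborel (\<lambda>x. ennreal (f x))"

definition margin :: "(real ^ 'n) measure \<Rightarrow> 'n \<Rightarrow> real measure" where
  "margin M i = distr M borel (\<lambda>x. x $ i)"

definition tail :: "(real ^ 'n) measure \<Rightarrow> 'n \<Rightarrow> real \<Rightarrow> real" where
  "tail M i t = 1 - cdf (margin M i) t"

text \<open>The law \<open>N\<close> of a random vector with uniform margins represents the copula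
  \<open>C u = measure N {..u}\<close>; the order on vectors is componentwise, so \<open>measure M {..x}\<close> is the
  joint distribution function.\<close>

definition copula_law :: "(real ^ 'n) measure \<Rightarrow> (real ^ 'n) measure \<Rightarrow> bool" where
  "copula_law M N \<longleftrightarrow> prob_space N \<and> sets N = sets borel
     \<and> (\<forall>i. margin N i = uniform_measure lborel {0..1})
     \<and> (\<forall>x. measure M {..x} = measure N {..(\<chi> i. cdf (margin M i) (x $ i))})"

text \<open>Unlike \<open>asymp_equiv\<close>, this is the plain limit of the quotient: since \<open>x / 0 = 0\<close>, it forces
  both functions to be eventually nonzero, which excludes bounded right tails below.\<close>

definition tail_equiv :: "(real \<Rightarrow> real) \<Rightarrow> (real \<Rightarrow> real) \<Rightarrow> bool" where
  "tail_equiv g h \<longleftrightarrow> ((\<lambda>t. g t / h t) \<longlongrightarrow> 1) at_top"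

definition locally_uniform_limit ::
    "'a::topological_space set \<Rightarrow> ('b \<Rightarrow> 'a \<Rightarrow> real) \<Rightarrow> ('a \<Rightarrow> real) \<Rightarrow> 'b filter \<Rightarrow> bool" where
  "locally_uniform_limit S g l F \<longleftrightarrow> (\<forall>K. compact K \<and> K \<subseteq> S \<longrightarrow> uniform_limit K g l F)"

text \<open>Scaling functions only matter, and are only required to be positive, near the limit point.\<close>

definition slowly_varying_at_0 :: "(real \<Rightarrow> real) \<Rightarrow> bool" where
  "slowly_varying_at_0 l \<longleftrightarrow> continuous_on {0<..} l \<and> (\<forall>\<^sub>F u in at_right 0. 0 < l u)
     \<and> (\<forall>x>0. ((\<lambda>u. l (u * x) / l u) \<longlongrightarrow> 1) (at_right 0))"

text \<open>This is the pointwise notion. Choosing the auxiliary function differentiable with derivative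
  tending to \<open>0\<close> makes the convergence locally uniform in \<open>x\<close>; that consequence of the usual
  normalization is a separate hypothesis where it is needed, so that continuous but not
  differentiable auxiliary functions are covered too.\<close>

definition self_neglecting :: "(real \<Rightarrow> real) \<Rightarrow> bool" where
  "self_neglecting m \<longleftrightarrow> m \<in> borel_measurable borel \<and> (\<forall>t. 0 < m t)
     \<and> (\<forall>x. ((\<lambda>t. m (t + m t * x) / m t) \<longlongrightarrow> 1) at_top)"

definition Gamma_minus1 :: "(real \<Rightarrow> real) \<Rightarrow> (real \<Rightarrow> real) set" where
  "Gamma_minus1 m = {V. V \<in> borel_measurable borel \<and> (\<forall>\<^sub>F t in at_top. 0 < V t)
     \<and> (\<forall>x. ((\<lambda>t. V (t + m t * x) / V t) \<longlongrightarrow> exp (- x)) at_top)}"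

definition copula_upper_tail ::
    "(real ^ 'n \<Rightarrow> real) \<Rightarrow> real \<Rightarrow> (real \<Rightarrow> real) \<Rightarrow> (real ^ 'n \<Rightarrow> real) \<Rightarrow> bool" where
  "copula_upper_tail c \<kappa> l lamU \<longleftrightarrow>
     locally_uniform_limit {w. \<forall>i. 0 < w $ i}
       (\<lambda>u w. c (\<chi> i. 1 - u * w $ i) / (u powr (\<kappa> - real CARD('n)) * l u)) lamU (at_right 0)
     \<and> (\<forall>w. (\<forall>i. 0 < w $ i) \<longrightarrow> 0 < lamU w)"

definition density_upper_tail ::
    "(real ^ 'n \<Rightarrow> real) \<Rightarrow> (real \<Rightarrow> real) \<Rightarrow> real \<Rightarrow> (real \<Rightarrow> real) \<Rightarrow> (real ^ 'n \<Rightarrow> real) \<Rightarrow> bool" where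
  "density_upper_tail f m \<kappa> V lam \<longleftrightarrow>
     locally_uniform_limit UNIV
       (\<lambda>t x. f (\<chi> i. t + m t * x $ i) / (m t powr (- real CARD('n)) * V t powr \<kappa>)) lam at_top
     \<and> (\<forall>x. 0 < lam x)"

definition exp_transform :: "real ^ 'n \<Rightarrow> real ^ 'n \<Rightarrow> real ^ 'n" where
  "exp_transform a x = (\<chi> i. a $ i * exp (- x $ i))"

definition tail_density_relation ::
    "real ^ 'n \<Rightarrow> (real ^ 'n \<Rightarrow> real) \<Rightarrow> (real ^ 'n \<Rightarrow> real) \<Rightarrow> bool" where
  "tail_density_relation a lam lamU \<longleftrightarrow>
     (\<forall>x. lam x = (\<Prod>i\<in>UNIV. a $ i) * exp (- (\<Sum>i\<in>UNIV. x $ i)) * lamU (exp_transform a x)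
        \<and> lam x = lamU (exp_transform a x) * \<bar>det (jacobian (exp_transform a) (at x))\<bar>)"

text \<open>With \<open>G\<close> the tail of the first margin, the scaling function of the density that belongs to
  the slowly varying function \<open>l\<close> of the copula density.\<close>

definition scaling :: "(real \<Rightarrow> real) \<Rightarrow> (real \<Rightarrow> real) \<Rightarrow> real \<Rightarrow> real \<Rightarrow> real" where
  "scaling G l \<kappa> t = G t * l (G t) powr (1 / \<kappa>)"

end

theory Submission
  imports Defs
begin

text \<open>Write \<open>G\<close> for the tail of the first margin and substitute \<open>u = G t\<close>. Uniformly on compact sets,
  the tail of margin \<open>i\<close> at \<open>t + m t * x\<close> divided by \<open>G t\<close> tends to \<open>a\<^sub>i exp (- x)\<close>, and \<open>m t\<close> times its
  density there divided by \<open>G t\<close> has the same limit, so the factorization of \<open>f\<close> through the copula density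
  turns either condition into the other. Everything rests on the uniform convergence theorem for
  Beurling varying functions, which also covers slowly varying functions (with \<open>m = 1\<close> after
  \<open>u = exp (- s)\<close>), and on \<open>G t \<sim> m t * f\<^sub>1 t\<close>.

  Locally uniform limits with continuous limit function are treated as limits along the product filter
  \<open>F \<times>\<^sub>F nhds x\<close>, so that locally uniform statements compose like ordinary limits.\<close>

text \<open>Changing variables moves the base point and the argument at the same time:
  \<open>c\<close> is evaluated at tails that depend on \<open>t\<close>, and \<open>f\<close> at
  quantiles that depend on \<open>u\<close>. Pointwise limits do not survive this; joint limits do.
  Regularity is the obstacle. Continuity of the limit functions is not assumed, so it has to be
  inherited from \<open>c\<close>, which is continuous only near the corner, and from the marginal
  densities. \<open>V\<close> is merely measurable and \<open>m\<close> need not be continuous,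
  while \<open>l\<close> must be continuous. Therefore the uniform convergence theorem is applied
  only to continuous functions, and \<open>l\<close> is built from \<open>f\<close> on the diagonal
  instead of from \<open>V\<close>. The gap between \<open>\<kappa> > 0\<close> and
  \<open>\<kappa> \<ge> 1\<close> cannot be closed by a change of variables, which keeps the
  exponent. There the measure itself enters: a lower bound of \<open>f\<close> on a cube gives mass,
  and this mass is limited by a marginal tail.\<close>

subsection \<open>Locally uniform limits\<close>

lemma locally_uniform_limit_tendsto:
  fixes g :: "'b \<Rightarrow> 'a::heine_borel \<Rightarrow> real"
  assumes lu: "locally_uniform_limit S g l F" and S: "open S" and l: "continuous_on S l" and x: "x \<in> S"
  shows "((\<lambda>p. g (fst p) (snd p)) \<longlongrightarrow> l x) (F \<times>\<^sub>F nhds x)"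
proof (rule tendstoI)
  fix e :: real assume e: "e > 0"
  obtain r where r: "r > 0" "cball x r \<subseteq> S" using S x open_contains_cball by blast
  have "uniform_limit (cball x r) g l F"
    using lu r unfolding locally_uniform_limit_def by auto
  then have 1: "\<forall>\<^sub>F t in F. \<forall>y\<in>cball x r. dist (g t y) (l y) < e/2"
    using e by (auto simp: uniform_limit_iff dest: spec[of _ "e/2"])
  have "(l \<longlongrightarrow> l x) (nhds x)"
    using l S x continuous_on_eq_continuous_at[OF S] isCont_def tendsto_at_iff_tendsto_nhds by blast
  then have 2: "\<forall>\<^sub>F y in nhds x. dist (l y) (l x) < e/2 \<and> y \<in> cball x r"
    using e r by (intro eventually_conj tendstoD)
      (auto intro!: eventually_nhds_in_open[THEN eventually_mono, of "ball x r"])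
  show "\<forall>\<^sub>F p in F \<times>\<^sub>F nhds x. dist (g (fst p) (snd p)) (l x) < e"
    unfolding eventually_prod_filter
  proof (rule exI, rule exI, intro conjI, rule 1, rule 2, clarsimp)
    fix t y assume "\<forall>y\<in>cball x r. dist (g t y) (l y) * 2 < e" "dist (l y) (l x) * 2 < e" "dist x y \<le> r"
    then show "dist (g t y) (l x) < e" using dist_triangle[of "g t y" "l x" "l y"] by force
  qed
qed

lemma tendsto_locally_uniform_limit:
  fixes g :: "'b \<Rightarrow> 'a::topological_space \<Rightarrow> real"
  assumes F: "F \<noteq> bot"
    and cc: "\<And>x. x \<in> S \<Longrightarrow> ((\<lambda>p. g (fst p) (snd p)) \<longlongrightarrow> l x) (F \<times>\<^sub>F nhds x)"
  shows "locally_uniform_limit S g l F"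
  unfolding locally_uniform_limit_def
proof (intro allI impI uniform_limitI)
  fix K :: "'a set" and e :: real
  assume K: "compact K \<and> K \<subseteq> S" and e: "e > 0"
  have "\<forall>x\<in>K. \<exists>U. open U \<and> x \<in> U \<and> (\<forall>\<^sub>F t in F. \<forall>y\<in>U. dist (g t y) (l x) < e/4)"
  proof
    fix x assume "x \<in> K"
    have "\<forall>\<^sub>F p in F \<times>\<^sub>F nhds x. dist (g (fst p) (snd p)) (l x) < e/4"
      using cc[of x] \<open>x \<in> K\<close> K e by (intro tendstoD) auto
    then obtain P Q where P: "eventually P F" and Q: "eventually Q (nhds x)"
      and PQ: "\<forall>t y. P t \<longrightarrow> Q y \<longrightarrow> dist (g t y) (l x) < e/4"
      unfolding eventually_prod_filter by auto
    from Q obtain U where "open U" "x \<in> U" "\<forall>y\<in>U. Q y"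
      unfolding eventually_nhds by blast
    moreover from this PQ have "\<forall>\<^sub>F t in F. \<forall>y\<in>U. dist (g t y) (l x) < e/4"
      by (intro eventually_mono[OF P]) blast
    ultimately show "\<exists>U. open U \<and> x \<in> U \<and> (\<forall>\<^sub>F t in F. \<forall>y\<in>U. dist (g t y) (l x) < e/4)" by blast
  qed
  from bchoice[OF this] obtain U where U: "\<And>x. x \<in> K \<Longrightarrow> open (U x) \<and> x \<in> U x \<and>
      (\<forall>\<^sub>F t in F. \<forall>y\<in>U x. dist (g t y) (l x) < e/4)" by blast
  obtain D where D: "D \<subseteq> K" "finite D" "K \<subseteq> (\<Union>x\<in>D. U x)"
  proof (rule compactE_image[of K K U])
    show "compact K" using K by simp
    show "K \<subseteq> (\<Union>x\<in>K. U x)" using U by blast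
  qed (use U in blast)+
  \<comment> \<open>Continuity of \<open>l\<close> is not a hypothesis; it comes from fixing
    \<open>y\<close> and passing to the limit along the nontrivial filter \<open>F\<close> in the
    estimate that is uniform on \<open>U x\<close>.\<close>
  have l: "dist (l y) (l x) \<le> e/4" if "x \<in> D" "y \<in> U x" "y \<in> K" for x y
  proof (rule tendsto_upperbound[OF _ _ F])
    have "((\<lambda>t. g t y) \<longlongrightarrow> l y) F"
    proof -
      have "filterlim (\<lambda>t. (t, y)) (F \<times>\<^sub>F nhds y) F"
        by (intro filterlim_Pair filterlim_ident tendsto_const)
      from filterlim_compose[OF cc this] show ?thesis using that K by auto
    qed
    then show "((\<lambda>t. dist (g t y) (l x)) \<longlongrightarrow> dist (l y) (l x)) F"
      by (intro tendsto_intros)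
    show "\<forall>\<^sub>F t in F. dist (g t y) (l x) \<le> e/4"
    proof -
      have "\<forall>\<^sub>F t in F. \<forall>y\<in>U x. dist (g t y) (l x) < e/4" using U that D by blast
      then show ?thesis by eventually_elim (use that in force)
    qed
  qed
  have "\<forall>\<^sub>F t in F. \<forall>x\<in>D. \<forall>y\<in>U x. dist (g t y) (l x) < e/4"
    using U D by (intro eventually_ball_finite) auto
  then show "\<forall>\<^sub>F t in F. \<forall>y\<in>K. dist (g t y) (l y) < e"
  proof eventually_elim
    case (elim t)
    show ?case
    proof
      fix y assume y: "y \<in> K"
      then obtain x where x: "x \<in> D" "y \<in> U x" using D by auto
      have "dist (g t y) (l x) < e/4" "dist (l y) (l x) \<le> e/4" using elim x l y by auto
      then show "dist (g t y) (l y) < e"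
        using dist_triangle2[of "g t y" "l y" "l x"] e by simp
    qed
  qed
qed

lemma tendsto_Pair_compose:
  assumes "((\<lambda>p. g (fst p) (snd p)) \<longlongrightarrow> L) (F \<times>\<^sub>F nhds x)"
    and "filterlim a F G" and "filterlim b (nhds x) G"
  shows "((\<lambda>q. g (a q) (b q)) \<longlongrightarrow> L) G"
  using filterlim_compose[OF assms(1) filterlim_Pair[OF assms(2,3)]] by simp

lemma tendsto_transform:
  "(f \<longlongrightarrow> L) F \<Longrightarrow> \<forall>\<^sub>F x in F. f x = g x \<Longrightarrow> L = L' \<Longrightarrow> (g \<longlongrightarrow> L') F"
  using Lim_transform_eventually by blast

lemma filterlim_fst_prod: "filterlim g H F \<Longrightarrow> filterlim (\<lambda>p. g (fst p)) H (F \<times>\<^sub>F G)"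
  using filterlim_compose[OF _ filterlim_fst] .

text \<open>Both tail conditions are silent about continuity of their limit functions, and this
  supplies it. Continuity of \<open>g t\<close> is required only near \<open>x\<close> and for late
  \<open>t\<close>, because \<open>c\<close> is known to be continuous only near the corner.\<close>

lemma locally_uniform_limit_continuous:
  fixes g :: "'b \<Rightarrow> 'a::heine_borel \<Rightarrow> real"
  assumes lu: "locally_uniform_limit S g l F" and F: "F \<noteq> bot" and S: "open S"
    and cont: "\<And>x. x \<in> S \<Longrightarrow> \<forall>\<^sub>F p in F \<times>\<^sub>F nhds x. isCont (g (fst p)) (snd p)"
  shows "continuous_on S l"
proof -
  have "isCont l x" if x: "x \<in> S" for x
  proof -
    obtain P Q where P: "eventually P F" and Q: "eventually Q (nhds x)"
      and PQ: "\<And>t y. P t \<Longrightarrow> Q y \<Longrightarrow> isCont (g t) y"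
      using cont[OF x] unfolding eventually_prod_filter by auto
    obtain U where U: "open U" "x \<in> U" "\<And>y. y \<in> U \<Longrightarrow> Q y"
      using Q unfolding eventually_nhds by blast
    have "open (S \<inter> U)" "x \<in> S \<inter> U" using S U x by auto
    then obtain r where r: "r > 0" "cball x r \<subseteq> S \<inter> U" using open_contains_cball by blast
    have "uniform_limit (cball x r) g l F"
      using lu r unfolding locally_uniform_limit_def by auto
    moreover have "\<forall>\<^sub>F t in F. continuous_on (cball x r) (g t)"
      using P by eventually_elim (use PQ U r in \<open>blast intro: continuous_at_imp_continuous_on\<close>)
    ultimately have "continuous_on (cball x r) l"
      using uniform_limit_theorem F by blast
    then have "continuous_on (ball x r) l" by (rule continuous_on_subset) auto
    then show ?thesis using r continuous_on_eq_continuous_at[of "ball x r" l] by simp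
  qed
  then show ?thesis by (simp add: continuous_at_imp_continuous_on)
qed

subsection \<open>Beurling variation\<close>

locale beurling =
  fixes m :: "real \<Rightarrow> real"
  assumes m_pos: "0 < m t"
    and m_uniform: "locally_uniform_limit UNIV (\<lambda>t x. m (t + m t * x) / m t) (\<lambda>x. 1) at_top"
begin

lemma m_ratio: "((\<lambda>p. m (fst p + m (fst p) * snd p) / m (fst p)) \<longlongrightarrow> 1) (at_top \<times>\<^sub>F nhds x)"
  using locally_uniform_limit_tendsto[OF m_uniform] by simp

lemma m_ratio_uniform:
  assumes "compact K" "e > 0"
  shows "\<forall>\<^sub>F t in at_top. \<forall>x\<in>K. \<bar>m (t + m t * x) / m t - 1\<bar> < e"
proof -
  have "uniform_limit K (\<lambda>t x. m (t + m t * x) / m t) (\<lambda>x. 1) at_top"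
    using m_uniform assms(1) unfolding locally_uniform_limit_def by auto
  then show ?thesis using assms(2) by (auto simp: uniform_limit_iff dist_real_def)
qed

text \<open>If \<open>m t > e * t\<close> for large \<open>t\<close>, then the origin is \<open>t + m t * x\<close> for a bounded \<open>x\<close>, so that
  \<open>m 0\<close> is comparable to \<open>m t\<close>.\<close>

lemma m_small:
  assumes e: "e > 0"
  shows "\<forall>\<^sub>F t in at_top. m t \<le> e * t"
proof -
  have "\<forall>\<^sub>F t in at_top. \<forall>x\<in>{-1/e..0}. \<bar>m (t + m t * x) / m t - 1\<bar> < 1/2"
    by (rule m_ratio_uniform) auto
  then show ?thesis
    using eventually_gt_at_top[of 0] eventually_ge_at_top[of "2 * m 0 / e"]
  proof eventually_elim
    case (elim t)
    show ?case
    proof (rule ccontr)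
      assume "\<not> m t \<le> e * t"
      then have *: "e * t < m t" by simp
      have "- t / m t \<in> {-1/e..0}"
        using * m_pos[of t] e elim by (auto simp: field_simps)
      then have "\<bar>m (t + m t * (- t / m t)) / m t - 1\<bar> < 1/2" using elim by blast
      moreover have "t + m t * (- t / m t) = 0" using m_pos[of t] by simp
      ultimately have "\<bar>m 0 / m t - 1\<bar> < 1/2" by simp
      then have "m 0 / m t > 1/2" by linarith
      then have "m t < 2 * m 0" using m_pos[of t] by (simp add: field_simps)
      moreover have "2 * m 0 \<le> e * t" using elim e by (simp add: field_simps)
      ultimately show False using * by simp
    qed
  qed
qed

text \<open>By \<open>m_small\<close>, a displacement by fewer than \<open>B\<close> units of
  \<open>m t\<close> has length at most \<open>t / 2\<close> for large \<open>t\<close>, so at least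
  half of \<open>t\<close> remains.\<close>

lemma shift_at_top: "filterlim (\<lambda>p. fst p + m (fst p) * snd p) at_top (at_top \<times>\<^sub>F nhds x)"
  unfolding filterlim_at_top
proof
  fix Z :: real
  define B where "B = \<bar>x\<bar> + 1"
  have B: "B > 0" by (simp add: B_def)
  have "\<forall>\<^sub>F t in at_top. m t \<le> (1/(2*B)) * t \<and> t \<ge> 2 * Z \<and> t > 0"
    using B by (intro eventually_conj m_small) (auto intro: eventually_ge_at_top eventually_gt_at_top)
  moreover have "\<forall>\<^sub>F y in nhds x. \<bar>y\<bar> < B"
  proof -
    have "((\<lambda>y. \<bar>y\<bar>) \<longlongrightarrow> \<bar>x\<bar>) (nhds x)"
      by (intro tendsto_rabs) (simp add: filterlim_ident)
    then show ?thesis by (rule order_tendstoD) (simp add: B_def)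
  qed
  ultimately show "\<forall>\<^sub>F p in at_top \<times>\<^sub>F nhds x. Z \<le> fst p + m (fst p) * snd p"
    unfolding eventually_prod_filter
  proof (intro exI conjI allI impI)
    fix t y assume 1: "m t \<le> (1/(2*B)) * t \<and> t \<ge> 2 * Z \<and> t > 0" and 2: "\<bar>y\<bar> < B"
    have "\<bar>m t * y\<bar> \<le> (1/(2*B)) * t * B"
      unfolding abs_mult using 1 2 B m_pos[of t] by (intro mult_mono) auto
    also have "\<dots> = t/2" using B by simp
    finally show "Z \<le> fst (t,y) + m (fst (t,y)) * snd (t,y)" using 1 by auto
  qed
qed

lemma shift_at_top1: "filterlim (\<lambda>t. t + m t * x) at_top at_top"
proof -
  have "filterlim (\<lambda>t. (t, x)) (at_top \<times>\<^sub>F nhds x) (at_top::real filter)"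
    by (intro filterlim_Pair filterlim_ident tendsto_const)
  from filterlim_compose[OF shift_at_top this] show ?thesis by simp
qed

lemma m_ratio1: "((\<lambda>t. m (t + m t * x) / m t) \<longlongrightarrow> 1) at_top"
proof -
  have "filterlim (\<lambda>t. (t, x)) (at_top \<times>\<^sub>F nhds x) (at_top::real filter)"
    by (intro filterlim_Pair filterlim_ident tendsto_const)
  from filterlim_compose[OF m_ratio this] show ?thesis by simp
qed

text \<open>The uniform convergence theorem for Beurling varying functions, for continuous \<open>k\<close>. The Baire
  category theorem gives an interval \<open>{a..b}\<close> of uniformity for all large \<open>t\<close>; taking the base point
  \<open>s - m s * c\<close> with \<open>c\<close> the midpoint transports it to a neighbourhood of \<open>0\<close>.\<close>

lemma uniform_interval:
  fixes k :: "real \<Rightarrow> real"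
  assumes k: "continuous_on {T..} k"
    and lim: "\<And>x. ((\<lambda>t. k (t + m t * x) - k t) \<longlongrightarrow> - x) at_top"
    and e: "e > 0"
  obtains a b S where "a < b" "\<And>t y. t \<ge> S \<Longrightarrow> y \<in> {a..b} \<Longrightarrow> \<bar>k (t + m t * y) - k t + y\<bar> \<le> e"
proof -
  \<comment> \<open>Only \<open>y \<ge> 0\<close> is considered, so that \<open>t + m t * y\<close>
    stays in \<open>{T..}\<close>, where \<open>k\<close> is continuous; this makes every
    \<open>E n\<close> closed. Pointwise convergence makes the \<open>E n\<close> cover the unit
    interval.\<close>
  define E where "E n = {y\<in>{0..1::real}. \<forall>t\<ge>max T (real n). \<bar>k (t + m t * y) - k t + y\<bar> \<le> e}" for n
  have closed: "closed (E n)" for n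
  proof -
    have "closed {y\<in>{0..1}. \<bar>k (t + m t * y) - k t + y\<bar> \<le> e}" if "t \<ge> max T (real n)" for t
    proof -
      have "continuous_on {0..1} (\<lambda>y. k (t + m t * y))"
        using that m_pos[of t]
        by (intro continuous_on_compose2[OF k] continuous_intros) (auto intro: add_increasing2)
      then have "continuous_on {0..1} (\<lambda>y. \<bar>k (t + m t * y) - k t + y\<bar>)"
        by (intro continuous_intros)
      from continuous_closed_preimage[OF this, of "{..e}"]
      show ?thesis by (simp add: vimage_def Int_def)
    qed
    moreover have "E n = (\<Inter>t\<in>{max T (real n)..}. {y\<in>{0..1}. \<bar>k (t + m t * y) - k t + y\<bar> \<le> e})"
      unfolding E_def by auto
    ultimately show ?thesis by auto
  qed
  have E_D: "\<bar>k (t + m t * y) - k t + y\<bar> \<le> e" if "y \<in> E n" "t \<ge> max T (real n)" for y n t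
    using that unfolding E_def by blast
  have un: "\<exists>n. y \<in> E n" if y: "y \<in> {0..1}" for y
  proof -
    have "\<forall>\<^sub>F t in at_top. \<bar>k (t + m t * y) - k t + y\<bar> < e"
      using tendstoD[OF lim[of y] e] by (simp add: dist_real_def)
    then obtain S where "\<And>t. t \<ge> S \<Longrightarrow> \<bar>k (t + m t * y) - k t + y\<bar> < e"
      unfolding eventually_at_top_linorder by auto
    moreover obtain n where "real n \<ge> S" using real_arch_simple by blast
    ultimately have "y \<in> E n" using y unfolding E_def by (auto intro: less_imp_le)
    then show ?thesis ..
  qed
  \<comment> \<open>Baire by contradiction: if all complements of the \<open>E n\<close> were dense
    in the interval, so would be their intersection, which is empty by \<open>un\<close>.\<close>
  have "\<exists>n. \<not> {0..1} \<subseteq> closure ({0..1} - E n)"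
  proof (rule ccontr)
    assume c: "\<not> ?thesis"
    have "{0..1} \<subseteq> closure (\<Inter> (range (\<lambda>n. {0..1} - E n)))"
    proof (rule Baire)
      fix X assume "X \<in> range (\<lambda>n. {0..1} - E n)"
      then obtain n where X: "X = {0..1} - E n" by auto
      have "X = {0..1} \<inter> (- E n)" using X by auto
      then have "openin (top_of_set {0..1}) X" using closed[of n] by (metis open_Compl openin_open_Int)
      then show "openin (top_of_set {0..1}) X \<and> {0..1} \<subseteq> closure X" using c X by auto
    qed auto
    moreover have "\<Inter> (range (\<lambda>n. {0..1} - E n)) = {}" using un by blast
    ultimately have "{0..1::real} \<subseteq> {}" by (simp only: closure_empty)
    then show False by simp
  qed
  then obtain n x where x: "x \<in> {0..1}" "x \<notin> closure ({0..1} - E n)" by blast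
  then obtain r where r: "r > 0" "\<And>y. y \<in> {0..1} - E n \<Longrightarrow> r \<le> dist y x"
    unfolding closure_approachable by force
  have "max 0 (x - r/2) < min 1 (x + r/2)" using x r by auto
  moreover have "y \<in> E n" if "y \<in> {max 0 (x - r/2)..min 1 (x + r/2)}" for y
    using that r(1) r(2)[of y] by (force simp: dist_real_def)
  ultimately show thesis
    using that[of "max 0 (x - r/2)" "min 1 (x + r/2)" "max T (real n)"] E_D by blast
qed

lemma equicontinuous:
  fixes k :: "real \<Rightarrow> real"
  assumes k: "continuous_on {T..} k"
    and lim: "\<And>x. ((\<lambda>t. k (t + m t * x) - k t) \<longlongrightarrow> - x) at_top"
  shows "((\<lambda>p. k (fst p + m (fst p) * snd p) - k (fst p)) \<longlongrightarrow> 0) (at_top \<times>\<^sub>F nhds 0)"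
proof (rule tendstoI)
  fix e0 :: real assume "e0 > 0"
  define e where "e = e0 / 3"
  have e: "e > 0" using \<open>e0 > 0\<close> by (simp add: e_def)
  obtain a b S where ab: "a < b" and
    S: "\<And>t y. t \<ge> S \<Longrightarrow> y \<in> {a..b} \<Longrightarrow> \<bar>k (t + m t * y) - k t + y\<bar> \<le> e"
    using uniform_interval[OF k lim e] by blast
  define c where "c = (a + b)/2"
  define t where "t s = s + m s * (- c)" for s
  \<comment> \<open>\<open>r\<close> converts the unit \<open>m s\<close> into the unit
    \<open>m (t s)\<close>. Seen from \<open>t s\<close>, the points \<open>s\<close> and
    \<open>s + m s * z\<close> are displaced by \<open>c * r s\<close> and
    \<open>(c + z) * r s\<close>; both lie in \<open>{a..b}\<close> once \<open>s\<close> is large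
    and \<open>z\<close> small. Subtracting the two uniform estimates leaves \<open>z * r s\<close>,
    whence three errors of size \<open>e\<close>.\<close>
  define r where "r s = m s / m (t s)" for s
  have t: "filterlim t at_top at_top" unfolding t_def by (rule shift_at_top1)
  have r: "(r \<longlongrightarrow> 1) at_top"
    using tendsto_inverse[OF m_ratio1[of "-c"]] unfolding r_def t_def by simp
  let ?F = "at_top \<times>\<^sub>F nhds (0::real)"
  have r': "((\<lambda>p. r (fst p)) \<longlongrightarrow> 1) ?F" by (rule filterlim_fst_prod[OF r])
  have s: "(snd \<longlongrightarrow> 0) ?F" by (rule filterlim_snd)
  have 1: "((\<lambda>p. c * r (fst p)) \<longlongrightarrow> c) ?F" using tendsto_mult[OF tendsto_const r', of c] by simp
  have 2: "((\<lambda>p. (c + snd p) * r (fst p)) \<longlongrightarrow> c) ?F"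
    using tendsto_mult[OF tendsto_add[OF tendsto_const s] r', of c] by simp
  have 3: "((\<lambda>p. snd p * r (fst p)) \<longlongrightarrow> 0) ?F" using tendsto_mult[OF s r'] by simp
  have c: "a < c" "c < b" using ab by (auto simp: c_def)
  have 4: "\<forall>\<^sub>F p in ?F. t (fst p) \<ge> S"
    using filterlim_compose[OF t filterlim_fst, of "nhds 0"] unfolding filterlim_at_top by blast
  show "\<forall>\<^sub>F p in ?F. dist (k (fst p + m (fst p) * snd p) - k (fst p)) 0 < e0"
    using order_tendstoD(1)[OF 1 c(1)] order_tendstoD(2)[OF 1 c(2)]
      order_tendstoD(1)[OF 2 c(1)] order_tendstoD(2)[OF 2 c(2)] 4 tendstoD[OF 3 e]
  proof eventually_elim
    case (elim p)
    let ?s = "fst p" let ?z = "snd p" let ?t = "t (fst p)"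
    have mr: "m ?t * r ?s = m ?s" unfolding r_def using m_pos[of ?t] by simp
    have "?t + m ?t * (c * r ?s) = ?t + (m ?t * r ?s) * c" by (simp add: algebra_simps)
    also have "\<dots> = ?s" unfolding mr by (simp add: t_def)
    finally have A: "?t + m ?t * (c * r ?s) = ?s" .
    have "?t + m ?t * ((c + ?z) * r ?s) = ?t + (m ?t * r ?s) * (c + ?z)" by (simp add: algebra_simps)
    also have "\<dots> = ?s + m ?s * ?z" unfolding mr by (simp add: t_def algebra_simps)
    finally have B: "?t + m ?t * ((c + ?z) * r ?s) = ?s + m ?s * ?z" .
    have "\<bar>k ?s - k ?t + c * r ?s\<bar> \<le> e" using S[of ?t "c * r ?s"] elim unfolding A by auto
    moreover have "\<bar>k (?s + m ?s * ?z) - k ?t + (c + ?z) * r ?s\<bar> \<le> e"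
      using S[of ?t "(c + ?z) * r ?s"] elim unfolding B by auto
    moreover have "\<bar>?z * r ?s\<bar> < e" using elim by (simp add: dist_real_def)
    moreover have "(c + ?z) * r ?s = c * r ?s + ?z * r ?s" by (rule distrib_right)
    ultimately show ?case unfolding dist_real_def e_def by linarith
  qed
qed

text \<open>The displacement is split at the fixed \<open>x\<close>: the pointwise limit handles the
  move to \<open>t + m t * x\<close>, and the rest, rescaled to the unit of \<open>m\<close> at that
  point, tends to 0 and falls under \<open>equicontinuous\<close>.\<close>

lemma uniform_convergence_log:
  fixes k :: "real \<Rightarrow> real"
  assumes k: "continuous_on {T..} k"
    and lim: "\<And>x. ((\<lambda>t. k (t + m t * x) - k t) \<longlongrightarrow> - x) at_top"
  shows "((\<lambda>p. k (fst p + m (fst p) * snd p) - k (fst p)) \<longlongrightarrow> - x) (at_top \<times>\<^sub>F nhds x)"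
proof -
  let ?F = "at_top \<times>\<^sub>F nhds x"
  let ?s = "\<lambda>p. fst p + m (fst p) * x"
  have s: "filterlim ?s at_top ?F" by (rule filterlim_fst_prod[OF shift_at_top1])
  have r: "((\<lambda>p. m (fst p) / m (?s p)) \<longlongrightarrow> 1) ?F"
    using tendsto_inverse[OF filterlim_fst_prod[OF m_ratio1]] by simp
  have sx: "(snd \<longlongrightarrow> x) ?F" by (rule filterlim_snd)
  have z: "((\<lambda>p. (snd p - x) * (m (fst p) / m (?s p))) \<longlongrightarrow> 0) ?F"
    using tendsto_mult[OF tendsto_diff[OF sx tendsto_const] r, of x] by simp
  have "((\<lambda>p. k (?s p + m (?s p) * ((snd p - x) * (m (fst p) / m (?s p)))) - k (?s p)) \<longlongrightarrow> 0) ?F"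
    by (rule tendsto_Pair_compose[OF equicontinuous[OF k lim] s z])
  from tendsto_add[OF this filterlim_fst_prod[OF lim[of x]]]
  have "((\<lambda>p. k (?s p + m (?s p) * ((snd p - x) * (m (fst p) / m (?s p)))) - k (fst p)) \<longlongrightarrow> - x) ?F"
    by simp
  moreover have "?s p + m (?s p) * ((snd p - x) * (m (fst p) / m (?s p))) = fst p + m (fst p) * snd p" for p
  proof -
    have "m (?s p) * ((snd p - x) * (m (fst p) / m (?s p))) = (snd p - x) * m (fst p)"
      using m_pos[of "?s p"] by simp
    then show ?thesis by (simp only:) (simp add: algebra_simps)
  qed
  ultimately show ?thesis by (simp only:)
qed

lemma uniform_convergence:
  fixes h :: "real \<Rightarrow> real"
  assumes h: "continuous_on {T..} h" and pos: "\<forall>\<^sub>F t in at_top. 0 < h t"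
    and lim: "\<And>x. ((\<lambda>t. h (t + m t * x) / h t) \<longlongrightarrow> exp (- x)) at_top"
  shows "((\<lambda>p. h (fst p + m (fst p) * snd p) / h (fst p)) \<longlongrightarrow> exp (- x)) (at_top \<times>\<^sub>F nhds x)"
proof -
  obtain T' where T': "\<And>t. t \<ge> T' \<Longrightarrow> 0 < h t" using pos unfolding eventually_at_top_linorder by auto
  have c: "continuous_on {max T T'..} (\<lambda>t. ln (h t))"
    using T' by (intro continuous_on_ln continuous_on_subset[OF h]) force+
  have l: "((\<lambda>t. ln (h (t + m t * x)) - ln (h t)) \<longlongrightarrow> - x) at_top" for x
  proof -
    have "((\<lambda>t. ln (h (t + m t * x) / h t)) \<longlongrightarrow> ln (exp (- x))) at_top"
      by (intro tendsto_ln lim) auto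
    moreover have "\<forall>\<^sub>F t in at_top. ln (h (t + m t * x) / h t) = ln (h (t + m t * x)) - ln (h t)"
      using pos eventually_compose_filterlim[OF pos shift_at_top1[of x]]
      by eventually_elim (simp add: ln_div)
    ultimately show ?thesis by (simp add: tendsto_cong)
  qed
  have "((\<lambda>p. exp (ln (h (fst p + m (fst p) * snd p)) - ln (h (fst p)))) \<longlongrightarrow> exp (- x)) (at_top \<times>\<^sub>F nhds x)"
    by (intro tendsto_exp uniform_convergence_log[OF c l])
  moreover have "\<forall>\<^sub>F p in at_top \<times>\<^sub>F nhds x. exp (ln (h (fst p + m (fst p) * snd p)) - ln (h (fst p)))
      = h (fst p + m (fst p) * snd p) / h (fst p)"
    using eventually_compose_filterlim[OF pos filterlim_fst[of at_top "nhds x"]] eventually_compose_filterlim[OF pos shift_at_top[of x]]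
    by eventually_elim (simp add: exp_diff)
  ultimately show ?thesis using tendsto_cong by (rule_tac iffD1[OF tendsto_cong])
qed

end

section \<open>Slow variation at 0 as a case of Beurling variation\<close>

lemma beurling_one: "beurling (\<lambda>_. 1)"
  by standard (auto simp: locally_uniform_limit_def uniform_limit_const)

lemma slowly_varying_tendsto:
  assumes l: "slowly_varying_at_0 l" and x: "x > 0"
  shows "((\<lambda>p. l (fst p * snd p) / l (fst p)) \<longlongrightarrow> 1) (at_right 0 \<times>\<^sub>F nhds x)"
proof -
  \<comment> \<open>The factor \<open>exp (- s)\<close> gives \<open>h\<close> the limit
    \<open>exp (- y)\<close> that \<open>uniform_convergence\<close> expects, where \<open>l\<close>
    alone would give 1. Division by \<open>snd p\<close> removes it again at the end.\<close>
  define h where "h s = l (exp (- s)) * exp (- s)" for s :: real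
  have ex: "filterlim (\<lambda>s::real. exp (- s)) (at_right 0) at_top"
  proof (rule tendsto_imp_filterlim_at_right)
    show "((\<lambda>s::real. exp (- s)) \<longlongrightarrow> 0) at_top"
      by (rule filterlim_compose[OF exp_at_bot filterlim_uminus_at_bot_at_top])
  qed simp
  have lc: "continuous_on {0<..} l" and lp: "\<forall>\<^sub>F u in at_right 0. 0 < l u"
    and ll: "\<And>x. x > 0 \<Longrightarrow> ((\<lambda>u. l (u * x) / l u) \<longlongrightarrow> 1) (at_right 0)"
    using l unfolding slowly_varying_at_0_def by auto
  have hc: "continuous_on {0..} h" unfolding h_def
    by (intro continuous_on_mult continuous_on_compose2[OF lc] continuous_intros) auto
  have hp: "\<forall>\<^sub>F s in at_top. 0 < h s"
    using eventually_compose_filterlim[OF lp ex] by eventually_elim (simp add: h_def)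
  have hl: "((\<lambda>s. h (s + 1 * y) / h s) \<longlongrightarrow> exp (- y)) at_top" for y
  proof -
    have "((\<lambda>s. l (exp (- s) * exp (- y)) / l (exp (- s)) * exp (- y)) \<longlongrightarrow> 1 * exp (- y)) at_top"
      by (intro tendsto_mult tendsto_const filterlim_compose[OF ll ex]) auto
    then show ?thesis unfolding h_def by (simp add: exp_diff exp_minus field_simps exp_add)
  qed
  interpret b: beurling "\<lambda>_. 1" by (rule beurling_one)
  let ?F = "at_right (0::real) \<times>\<^sub>F nhds x"
  have "filterlim (\<lambda>u. - ln u) at_top (at_right (0::real))"
    using ln_at_0 by (simp add: filterlim_uminus_at_top)
  then have f1: "filterlim (\<lambda>p. - ln (fst p)) at_top ?F" by (rule filterlim_fst_prod)
  have sx: "(snd \<longlongrightarrow> x) ?F" by (rule filterlim_snd)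
  have f2: "((\<lambda>p. - ln (snd p)) \<longlongrightarrow> - ln x) ?F" using x sx by (intro tendsto_intros) auto
  have "((\<lambda>p. h (- ln (fst p) + 1 * (- ln (snd p))) / h (- ln (fst p))) \<longlongrightarrow> exp (- (- ln x))) ?F"
    using b.uniform_convergence[OF hc hp hl, of "- ln x"] by (rule tendsto_Pair_compose[OF _ f1 f2])
  then have *: "((\<lambda>p. h (- ln (fst p) + 1 * (- ln (snd p))) / h (- ln (fst p)) / snd p) \<longlongrightarrow> x / x) ?F"
    using x sx by (intro tendsto_divide) auto
  have "\<forall>\<^sub>F p in ?F. fst p > 0"
    by (rule eventually_compose_filterlim[OF _ filterlim_fst]) (auto simp: eventually_at_filter)
  moreover have "\<forall>\<^sub>F p in ?F. snd p > 0" using order_tendstoD(1)[OF sx x] .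
  ultimately have "\<forall>\<^sub>F p in ?F. h (- ln (fst p) + 1 * (- ln (snd p))) / h (- ln (fst p)) / snd p
      = l (fst p * snd p) / l (fst p)"
    by eventually_elim (simp add: h_def exp_add field_simps)
  from iffD1[OF tendsto_cong[OF this] *] show ?thesis using x by simp
qed

section \<open>Orbits of unit steps and the asymptotics of a tail\<close>

context beurling
begin

text \<open>Successive points are one local unit apart. An inequality between \<open>t\<close> and
  \<open>t + m t\<close>, valid for all large \<open>t\<close>, can be iterated along an orbit and
  compared with the behaviour at infinity.\<close>

definition orbit :: "real \<Rightarrow> nat \<Rightarrow> real" where
  "orbit t n = ((\<lambda>s. s + m s) ^^ n) t"

lemma orbit_0 [simp]: "orbit t 0 = t"
  by (simp add: orbit_def)

lemma orbit_Suc [simp]: "orbit t (Suc n) = orbit t n + m (orbit t n)"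
  by (simp add: orbit_def)

lemma orbit_incseq: "incseq (orbit t)"
  by (rule incseq_SucI) (use m_pos in \<open>auto intro: less_imp_le\<close>)

lemma orbit_ge: "t \<le> orbit t n"
  using incseqD[OF orbit_incseq, of 0 n t] by simp

text \<open>A finite limit point \<open>L\<close> of an orbit would have \<open>m\<close> bounded below by \<open>m L / 2\<close> near \<open>L\<close>, while
  the increments of the orbit tend to \<open>0\<close>.\<close>

lemma orbit_at_top: "\<forall>\<^sub>F t in at_top. filterlim (orbit t) at_top sequentially"
proof -
  have "\<forall>\<^sub>F t in at_top. \<forall>x\<in>{-1..1}. \<bar>m (t + m t * x) / m t - 1\<bar> < 1/2"
    by (rule m_ratio_uniform) auto
  then obtain T where T: "\<And>t x. t \<ge> T \<Longrightarrow> x \<in> {-1..1} \<Longrightarrow> \<bar>m (t + m t * x) / m t - 1\<bar> < 1/2"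
    unfolding eventually_at_top_linorder by blast
  have "filterlim (orbit t) at_top sequentially" if t: "t \<ge> T" for t
  proof (cases "\<exists>B. \<forall>n. orbit t n \<le> B")
    case True
    then obtain L where L: "orbit t \<longlonglongrightarrow> L" "\<And>n. orbit t n \<le> L"
      using incseq_convergent[OF orbit_incseq] by metis
    have LT: "L \<ge> T" using L(2)[of 0] t by simp
    have "(\<lambda>n. m (orbit t n)) \<longlonglongrightarrow> L - L"
      using tendsto_diff[OF LIMSEQ_Suc[OF L(1)] L(1)] by simp
    then have "\<forall>\<^sub>F n in sequentially. m (orbit t n) < m L / 2"
      using m_pos[of L] by (intro order_tendstoD(2)) auto
    moreover have "\<forall>\<^sub>F n in sequentially. dist (orbit t n) L < m L"
      using m_pos[of L] by (intro tendstoD[OF L(1)])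
    ultimately have "\<forall>\<^sub>F n in sequentially. False"
    proof eventually_elim
      case (elim n)
      define x where "x = (orbit t n - L) / m L"
      have "\<bar>x\<bar> < 1"
        using elim m_pos[of L] by (simp add: x_def dist_real_def field_simps)
      then have "\<bar>m (L + m L * x) / m L - 1\<bar> < 1/2" using T[OF LT, of x] by (auto simp: abs_less_iff)
      moreover have "L + m L * x = orbit t n" using m_pos[of L] by (simp add: x_def)
      ultimately have "\<bar>m (orbit t n) / m L - 1\<bar> < 1/2" by (simp only:)
      then have "m (orbit t n) / m L > 1/2" by linarith
      then show False using elim m_pos[of L] by (simp add: field_simps)
    qed
    then show ?thesis by simp
  next
    case False
    show ?thesis unfolding filterlim_at_top
    proof
      fix Z
      obtain n where "orbit t n \<ge> Z" using False by (meson nle_le)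
      then have "\<forall>k\<ge>n. Z \<le> orbit t k" using incseqD[OF orbit_incseq] order_trans by blast
      then show "\<forall>\<^sub>F k in sequentially. Z \<le> orbit t k" unfolding eventually_sequentially by blast
    qed
  qed
  then show ?thesis unfolding eventually_at_top_linorder by blast
qed

text \<open>Along a divergent orbit \<open>S\<close> increases to its limit 0, so it starts at or
  below 0.\<close>

lemma orbit_nonpos:
  assumes S: "(S \<longlongrightarrow> 0) at_top" and step: "\<forall>\<^sub>F t in at_top. S t \<le> S (t + m t)"
  shows "\<forall>\<^sub>F t in at_top. S t \<le> (0::real)"
proof -
  from step obtain T where T: "\<And>t. t \<ge> T \<Longrightarrow> S t \<le> S (t + m t)"
    unfolding eventually_at_top_linorder by blast
  show ?thesis using eventually_ge_at_top[of T] orbit_at_top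
  proof eventually_elim
    case (elim t)
    have "incseq (\<lambda>n. S (orbit t n))"
      using T[OF order_trans[OF elim(1) orbit_ge]] by (intro incseq_SucI) simp
    moreover have "(\<lambda>n. S (orbit t n)) \<longlonglongrightarrow> 0" by (rule filterlim_compose[OF S elim(2)])
    ultimately show ?case using incseq_le[of "\<lambda>n. S (orbit t n)" 0 0] by simp
  qed
qed

text \<open>For \<open>q\<close> strictly between 1 and \<open>r\<close>, each step far out
  multiplies \<open>\<phi>\<close> by at least \<open>q\<close>, and the resulting geometric growth
  contradicts the bound. It serves to rule out exponents \<open>\<kappa> < 1\<close>.\<close>

lemma growth_unbounded:
  fixes \<phi> :: "real \<Rightarrow> real"
  assumes pos: "\<forall>\<^sub>F t in at_top. 0 < \<phi> t" and lim: "((\<lambda>t. \<phi> (t + m t) / \<phi> t) \<longlongrightarrow> r) at_top" and r: "r > 1"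
    and bd: "\<forall>\<^sub>F t in at_top. \<phi> t \<le> C"
  shows False
proof -
  define q where "q = (1 + r) / 2"
  have q: "1 < q" "q < r" using r by (auto simp: q_def)
  have "\<forall>\<^sub>F t in at_top. \<phi> t > 0 \<and> \<phi> t \<le> C \<and> \<phi> (t + m t) / \<phi> t > q"
    using pos bd order_tendstoD(1)[OF lim q(2)] by eventually_elim auto
  then obtain T where T: "\<And>t. t \<ge> T \<Longrightarrow> \<phi> t > 0 \<and> \<phi> t \<le> C \<and> \<phi> (t + m t) / \<phi> t > q"
    unfolding eventually_at_top_linorder by blast
  have ge: "orbit T n \<ge> T" for n by (rule orbit_ge)
  have *: "q ^ n * \<phi> T \<le> \<phi> (orbit T n)" for n
  proof (induction n)
    case (Suc n)
    have "q ^ Suc n * \<phi> T \<le> q * \<phi> (orbit T n)" using Suc q by (simp add: mult.assoc)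
    also have "\<dots> \<le> \<phi> (orbit T (Suc n))"
    proof -
      have "0 < \<phi> (orbit T n)" "q < \<phi> (orbit T n + m (orbit T n)) / \<phi> (orbit T n)"
        using T[OF ge[of n]] by auto
      then show ?thesis by (simp add: pos_less_divide_eq)
    qed
    finally show ?case .
  qed simp
  obtain n where "q ^ n > C / \<phi> T" using real_arch_pow[OF q(1)] by blast
  then have "q ^ n * \<phi> T > C" using T[of T] by (simp add: field_simps)
  then show False using *[of n] T[OF ge[of n]] by linarith
qed

text \<open>With the increment \<open>D t = H t - H (t + m t)\<close>, whose ratio along orbits tends to \<open>exp (- 1)\<close>, the
  function \<open>(1 - q) * H - D\<close> is monotone along orbits, in a direction that depends on whether
  \<open>q > exp (- 1)\<close>. This replaces summing a geometric series.\<close>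

lemma tail_asymptotic:
  assumes pos: "\<forall>\<^sub>F t in at_top. 0 < h t"
    and lim: "\<And>x. ((\<lambda>p. h (fst p + m (fst p) * snd p) / h (fst p)) \<longlongrightarrow> exp (- x)) (at_top \<times>\<^sub>F nhds x)"
    and H: "\<And>t. (H has_real_derivative - h t) (at t)" and H0: "(H \<longlongrightarrow> 0) at_top"
  shows "((\<lambda>t. H t / (m t * h t)) \<longlongrightarrow> 1) at_top"
proof -
  define D where "D t = H t - H (t + m t)" for t
  let ?c = "exp (-1) :: real"
  have c1: "?c < 1" by simp
  have sh: "filterlim (\<lambda>t. t + m t) at_top at_top" using shift_at_top1[of 1] by simp
  have D0: "(D \<longlongrightarrow> 0) at_top"
    unfolding D_def using tendsto_diff[OF H0 filterlim_compose[OF H0 sh]] by simp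
  have lu: "locally_uniform_limit UNIV (\<lambda>t x. h (t + m t * x) / h t) (\<lambda>x. exp (- x)) at_top"
    by (rule tendsto_locally_uniform_limit) (use lim in auto)
  have D1: "((\<lambda>t. D t / (m t * h t)) \<longlongrightarrow> 1 - ?c) at_top"
  proof (rule tendstoI)
    fix e :: real assume e: "e > 0"
    have "uniform_limit {0..1} (\<lambda>t x. h (t + m t * x) / h t) (\<lambda>x. exp (- x)) at_top"
      using lu unfolding locally_uniform_limit_def by auto
    then have "\<forall>\<^sub>F t in at_top. \<forall>v\<in>{0..1}. \<bar>h (t + m t * v) / h t - exp (- v)\<bar> < e"
      using e by (auto simp: uniform_limit_iff dist_real_def)
    then show "\<forall>\<^sub>F t in at_top. dist (D t / (m t * h t)) (1 - ?c) < e"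
      using pos
    proof eventually_elim
      case (elim t)
      \<comment> \<open>The derivative of \<open>E\<close> is the error in the uniform convergence
        of \<open>h\<close>. The mean value theorem on \<open>{0..1}\<close> therefore turns the
        error in the increment of \<open>H\<close> into that error at a single point, without
        integrals.\<close>
      define E where "E v = H (t + m t * v) / (m t * h t) - exp (- v)" for v
      have "(E has_real_derivative exp (- v) - h (t + m t * v) / h t) (at v)" for v
      proof -
        have "((\<lambda>v. H (t + m t * v)) has_real_derivative - h (t + m t * v) * m t) (at v)"
          by (rule DERIV_chain2[OF H]) (auto intro!: derivative_eq_intros)
        then show ?thesis unfolding E_def
          using m_pos[of t] elim(2) by (auto intro!: derivative_eq_intros simp: field_simps)
      qed
      then obtain z where z: "0 < z" "z < 1" "E 1 - E 0 = (1 - 0) * (exp (- z) - h (t + m t * z) / h t)"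
        using MVT2[of 0 1 E "\<lambda>v. exp (- v) - h (t + m t * v) / h t"] by auto
      have "E 0 - E 1 = D t / (m t * h t) - (1 - ?c)"
        unfolding E_def D_def by (simp add: diff_divide_distrib)
      then have "D t / (m t * h t) - (1 - ?c) = h (t + m t * z) / h t - exp (- z)" using z by simp
      then show ?case using elim(1) z by (auto simp: dist_real_def)
    qed
  qed
  have mh: "((\<lambda>t. (m (t + m t) * h (t + m t)) / (m t * h t)) \<longlongrightarrow> ?c) at_top"
  proof -
    have "filterlim (\<lambda>t. (t, 1)) (at_top \<times>\<^sub>F nhds (1::real)) (at_top::real filter)"
      by (intro filterlim_Pair filterlim_ident tendsto_const)
    from filterlim_compose[OF lim this] have "((\<lambda>t. h (t + m t) / h t) \<longlongrightarrow> ?c) at_top" by simp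
    from tendsto_mult[OF m_ratio1[of 1] this] show ?thesis by simp
  qed
  have pos': "\<forall>\<^sub>F t in at_top. 0 < h (t + m t)" by (rule eventually_compose_filterlim[OF pos sh])
  have Dpos: "\<forall>\<^sub>F t in at_top. D t > 0"
  proof -
    have "0 < 1 - ?c" using c1 by simp
    from order_tendstoD(1)[OF D1 this] pos show ?thesis
    proof eventually_elim
      case (elim t)
      moreover have "0 < m t * h t" using elim m_pos by simp
      ultimately show ?case by (simp add: zero_less_divide_iff)
    qed
  qed
  have D2: "((\<lambda>t. D (t + m t) / D t) \<longlongrightarrow> ?c) at_top"
  proof -
    have "((\<lambda>t. D (t + m t) / (m (t + m t) * h (t + m t)) / (D t / (m t * h t))
         * ((m (t + m t) * h (t + m t)) / (m t * h t))) \<longlongrightarrow> (1 - ?c) / (1 - ?c) * ?c) at_top"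
      using c1 by (intro tendsto_mult tendsto_divide D1 mh filterlim_compose[OF D1 sh]) auto
    moreover have "\<forall>\<^sub>F t in at_top. D (t + m t) / (m (t + m t) * h (t + m t)) / (D t / (m t * h t))
         * ((m (t + m t) * h (t + m t)) / (m t * h t)) = D (t + m t) / D t"
      using pos pos' Dpos
    proof eventually_elim
      case (elim t)
      then show ?case using m_pos[of t] m_pos[of "t + m t"] by (simp add: field_simps)
    qed
    ultimately show ?thesis by (rule tendsto_transform) (use c1 in simp)
  qed
  have up: "\<forall>\<^sub>F t in at_top. (1 - q) * H t \<le> D t" if q: "q > ?c" for q
  proof -
    have S: "((\<lambda>t. (1 - q) * H t - D t) \<longlongrightarrow> 0) at_top"
      using tendsto_diff[OF tendsto_mult[OF tendsto_const H0] D0, of "1 - q"] by simp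
    have "\<forall>\<^sub>F t in at_top. (1 - q) * H t - D t \<le> (1 - q) * H (t + m t) - D (t + m t)"
      using order_tendstoD(2)[OF D2 q] Dpos
    proof eventually_elim
      case (elim t)
      then have "D (t + m t) \<le> q * D t" by (simp add: field_simps)
      \<comment> \<open>One step changes \<open>(1 - q) * H - D\<close> by exactly
        \<open>q * D t - D (t + m t)\<close>, whose sign is controlled by \<open>D2\<close>.\<close>
      moreover have "(1 - q) * H (t + m t) = (1 - q) * H t - D t + q * D t"
        by (simp add: D_def algebra_simps)
      ultimately show ?case by linarith
    qed
    from orbit_nonpos[OF S this] show ?thesis by simp
  qed
  have down: "\<forall>\<^sub>F t in at_top. D t \<le> (1 - q) * H t" if q: "q < ?c" for q
  proof -
    have S: "((\<lambda>t. D t - (1 - q) * H t) \<longlongrightarrow> 0) at_top"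
      using tendsto_diff[OF D0 tendsto_mult[OF tendsto_const H0], of "1 - q"] by simp
    have "\<forall>\<^sub>F t in at_top. D t - (1 - q) * H t \<le> D (t + m t) - (1 - q) * H (t + m t)"
      using order_tendstoD(1)[OF D2 q] Dpos
    proof eventually_elim
      case (elim t)
      then have "q * D t \<le> D (t + m t)" by (simp add: field_simps)
      moreover have "(1 - q) * H (t + m t) = (1 - q) * H t - D t + q * D t"
        by (simp add: D_def algebra_simps)
      ultimately show ?case by linarith
    qed
    from orbit_nonpos[OF S this] show ?thesis by simp
  qed
  have Hpos: "\<forall>\<^sub>F t in at_top. H t > 0"
  proof -
    \<comment> \<open>The case \<open>q = 0\<close> already gives \<open>H t \<ge> D t > 0\<close>,
      which permits the division by \<open>H t\<close> below.\<close>
    have "\<forall>\<^sub>F t in at_top. D t \<le> (1 - 0) * H t" by (rule down) simp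
    with Dpos show ?thesis by eventually_elim simp
  qed
  have DH: "((\<lambda>t. D t / H t) \<longlongrightarrow> 1 - ?c) at_top"
  proof (rule order_tendstoI)
    fix a assume a: "a < 1 - ?c"
    define q where "q = (1 - a + ?c) / 2"
    have "?c < q" "a < 1 - q" using a by (auto simp: q_def field_simps)
    from up[OF this(1)] Hpos show "\<forall>\<^sub>F t in at_top. a < D t / H t"
    proof eventually_elim
      case (elim t)
      then have "1 - q \<le> D t / H t" by (simp add: field_simps)
      with \<open>a < 1 - q\<close> show ?case by linarith
    qed
  next
    fix a assume a: "1 - ?c < a"
    define q where "q = (1 - a + ?c) / 2"
    have "q < ?c" "1 - q < a" using a by (auto simp: q_def field_simps)
    from down[OF this(1)] Hpos show "\<forall>\<^sub>F t in at_top. D t / H t < a"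
    proof eventually_elim
      case (elim t)
      then have "D t / H t \<le> 1 - q" by (simp add: field_simps)
      with \<open>1 - q < a\<close> show ?case by linarith
    qed
  qed
  have "((\<lambda>t. D t / (m t * h t) / (D t / H t)) \<longlongrightarrow> (1 - ?c) / (1 - ?c)) at_top"
    using c1 by (intro tendsto_divide D1 DH) auto
  moreover have "\<forall>\<^sub>F t in at_top. D t / (m t * h t) / (D t / H t) = H t / (m t * h t)"
    using Dpos Hpos by eventually_elim simp
  ultimately show ?thesis by (rule tendsto_transform) (use c1 in simp)
qed

end

subsection \<open>The margins\<close>

text \<open>The margins are reduced to calculus: \<open>G i\<close> stands for the tail, known only
  through its derivative and its limit at infinity. The measures return when the locale is
  interpreted.\<close>

locale margins = beurling m for m +
  fixes G fi :: "'n::finite \<Rightarrow> real \<Rightarrow> real" and a :: "real ^ 'n" and first :: 'n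
  assumes G_deriv: "(G i has_real_derivative - fi i t) (at t)"
    and G_0: "(G i \<longlongrightarrow> 0) at_top"
    and fi_cont: "continuous_on UNIV (fi i)"
    and fi_nonneg: "0 \<le> fi i t"
    and a_pos: "0 < a $ i"
    and a_first: "a $ first = 1"
    and equiv: "tail_equiv (fi i) (\<lambda>t. a $ i * fi first t)"
    and gumbel: "tail_equiv (\<lambda>t. fi i (t + m t * x)) (\<lambda>t. fi i t * exp (- x))"
begin

lemma fi_pos: "\<forall>\<^sub>F t in at_top. 0 < fi i t"
proof -
  have "\<forall>\<^sub>F t in at_top. fi i t / (a $ i * fi first t) > 0"
    using equiv[of i] unfolding tail_equiv_def by (rule order_tendstoD) simp
  then show ?thesis
    by eventually_elim (use fi_nonneg[of i] in \<open>auto simp: less_le\<close>)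
qed

lemma fi_ratio: "((\<lambda>p. fi i (fst p + m (fst p) * snd p) / fi i (fst p)) \<longlongrightarrow> exp (- x)) (at_top \<times>\<^sub>F nhds x)"
proof (rule uniform_convergence[of 0])
  show "continuous_on {0..} (fi i)" using fi_cont by (rule continuous_on_subset) simp
  show "\<forall>\<^sub>F t in at_top. 0 < fi i t" by (rule fi_pos)
  fix x
  have "((\<lambda>t. fi i (t + m t * x) / (fi i t * exp (- x)) * exp (- x)) \<longlongrightarrow> 1 * exp (- x)) at_top"
    by (intro tendsto_mult tendsto_const gumbel[unfolded tail_equiv_def])
  then show "((\<lambda>t. fi i (t + m t * x) / fi i t) \<longlongrightarrow> exp (- x)) at_top" by simp
qed

lemma G_tail: "((\<lambda>t. G i t / (m t * fi i t)) \<longlongrightarrow> 1) at_top"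
  by (rule tail_asymptotic[OF fi_pos fi_ratio G_deriv G_0])

lemma G_antimono: "s \<le> t \<Longrightarrow> G i t \<le> G i s"
  using DERIV_nonpos_imp_nonincreasing[of s t "G i"] G_deriv fi_nonneg by (metis neg_le_0_iff_le)

text \<open>\<open>G_tail\<close> gives positivity far out, and monotonicity carries it back to
  every point: no margin has a right endpoint.\<close>

lemma G_pos: "0 < G i t"
proof -
  have "\<forall>\<^sub>F t in at_top. G i t / (m t * fi i t) > 0"
    using G_tail by (rule order_tendstoD) simp
  then have "\<forall>\<^sub>F s in at_top. 0 < G i s \<and> t \<le> s"
    using fi_pos[of i] eventually_ge_at_top[of t]
  proof eventually_elim
    case (elim s)
    moreover have "0 < m s * fi i s" using elim m_pos by simp
    ultimately show ?case by (simp add: zero_less_divide_iff)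
  qed
  then obtain s where "0 < G i s" "t \<le> s" using eventually_happens' trivial_limit_at_top_linorder by blast
  then show ?thesis using G_antimono[of t s i] by linarith
qed

lemma isCont_G: "isCont (G i) t"
  using G_deriv by (rule DERIV_isCont)

lemma G_at_right: "filterlim (G i) (at_right 0) at_top"
  using G_0 G_pos by (intro tendsto_imp_filterlim_at_right) auto

lemma fi_rel: "((\<lambda>t. fi i t / fi first t) \<longlongrightarrow> a $ i) at_top"
proof -
  have "((\<lambda>t. fi i t / (a $ i * fi first t) * a $ i) \<longlongrightarrow> 1 * a $ i) at_top"
    by (intro tendsto_mult tendsto_const equiv[unfolded tail_equiv_def])
  then show ?thesis using a_pos[of i] by simp
qed

lemma density_rel:
  "((\<lambda>p. m (fst p) * fi i (fst p + m (fst p) * snd p) / G first (fst p)) \<longlongrightarrow> a $ i * exp (- x)) (at_top \<times>\<^sub>F nhds x)"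
proof -
  let ?F = "at_top \<times>\<^sub>F nhds x"
  have "((\<lambda>p. fi i (fst p) / fi first (fst p) * (fi i (fst p + m (fst p) * snd p) / fi i (fst p))
      / (G first (fst p) / (m (fst p) * fi first (fst p)))) \<longlongrightarrow> a $ i * exp (- x) / 1) ?F"
    by (intro tendsto_mult tendsto_divide filterlim_fst_prod[OF fi_rel] filterlim_fst_prod[OF G_tail] fi_ratio) auto
  moreover have "\<forall>\<^sub>F p in ?F. fi i (fst p) / fi first (fst p) * (fi i (fst p + m (fst p) * snd p) / fi i (fst p))
      / (G first (fst p) / (m (fst p) * fi first (fst p))) = m (fst p) * fi i (fst p + m (fst p) * snd p) / G first (fst p)"
    using eventually_compose_filterlim[OF fi_pos[of i] filterlim_fst[of at_top "nhds x"]]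
      eventually_compose_filterlim[OF fi_pos[of first] filterlim_fst[of at_top "nhds x"]]
    by eventually_elim simp
  ultimately show ?thesis by (rule tendsto_transform) simp
qed

text \<open>At the moved point the tail is \<open>m\<close> times the density there, up to a factor
  tending to 1. Exchanging that \<open>m\<close> for \<open>m\<close> at the base point costs the
  factor \<open>m_ratio\<close>, and \<open>density_rel\<close> remains.\<close>

lemma G_rel:
  "((\<lambda>p. G i (fst p + m (fst p) * snd p) / G first (fst p)) \<longlongrightarrow> a $ i * exp (- x)) (at_top \<times>\<^sub>F nhds x)"
proof -
  let ?F = "at_top \<times>\<^sub>F nhds x"
  let ?s = "\<lambda>p. fst p + m (fst p) * snd p"
  have "((\<lambda>p. G i (?s p) / (m (?s p) * fi i (?s p)) * (m (?s p) / m (fst p)) * (m (fst p) * fi i (?s p) / G first (fst p)))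
      \<longlongrightarrow> 1 * 1 * (a $ i * exp (- x))) ?F"
    by (intro tendsto_mult density_rel m_ratio filterlim_compose[OF G_tail shift_at_top])
  moreover have "\<forall>\<^sub>F p in ?F. G i (?s p) / (m (?s p) * fi i (?s p)) * (m (?s p) / m (fst p)) * (m (fst p) * fi i (?s p) / G first (fst p))
     = G i (?s p) / G first (fst p)"
    using eventually_compose_filterlim[OF fi_pos[of i] shift_at_top[of x]]
  proof eventually_elim
    case (elim p)
    then show ?case using m_pos[of "fst p"] m_pos[of "?s p"] by simp
  qed
  ultimately show ?thesis by (rule tendsto_transform) simp
qed

lemma G_rel1: "((\<lambda>t. G i (t + m t * x) / G first t) \<longlongrightarrow> a $ i * exp (- x)) at_top"
  by (rule tendsto_Pair_compose[OF G_rel filterlim_ident tendsto_const])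

text \<open>Far to the left \<open>G i\<close> may be constant on intervals, so no global inverse
  exists and a choice is made; only small values \<open>v\<close> matter, for which the choice is
  forced.\<close>

definition quantile :: "'n \<Rightarrow> real \<Rightarrow> real" where
  "quantile i v = (SOME t. G i t = v)"

text \<open>Beyond some \<open>T\<close> the density is positive and \<open>G i\<close> strictly
  decreasing. Points before \<open>T\<close> have tails of at least \<open>G i T\<close>, so they
  cannot share a smaller value, and the chosen preimage is unique.\<close>

lemma quantile:
  obtains u0 where "u0 > 0" "\<And>v. v \<in> {0<..<u0} \<Longrightarrow> G i (quantile i v) = v"
    "continuous_on {0<..<u0} (quantile i)" "\<forall>\<^sub>F t in at_top. quantile i (G i t) = t"
proof -
  obtain T where T: "\<And>t. t \<ge> T \<Longrightarrow> 0 < fi i t"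
    using fi_pos[of i] unfolding eventually_at_top_linorder by blast
  have strict: "G i t < G i s" if "T \<le> s" "s < t" for s t
    using DERIV_neg_imp_decreasing[OF that(2), of "G i"] G_deriv T that by (metis neg_less_0_iff_less order_trans)
  have inv: "quantile i (G i t) = t" if "t > T" for t
    unfolding quantile_def
  proof (rule some_equality)
    fix s assume s: "G i s = G i t"
    show "s = t"
    proof (rule ccontr)
      assume "s \<noteq> t"
      then consider "s > t" | "s < t" "s \<ge> T" | "s < T" by linarith
      then show False
      proof cases
        case 1 then show False using strict[of t s] that s by simp
      next
        case 2 then show False using strict[of s t] s by simp
      next
        case 3 then show False using strict[of T t] G_antimono[of s T i] that s by simp
      qed
    qed
  qed simp
  have im: "{0<..<G i T} \<subseteq> G i ` {T<..}"
  proof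
    fix v assume v: "v \<in> {0<..<G i T}"
    then have "\<forall>\<^sub>F t in at_top. G i t < v \<and> T \<le> t"
      by (intro eventually_conj order_tendstoD(2)[OF G_0] eventually_ge_at_top) simp
    then obtain t where t: "G i t < v" "T \<le> t" using eventually_happens' trivial_limit_at_top_linorder by blast
    then obtain s where "T \<le> s" "s \<le> t" "G i s = v"
      using IVT2'[of "G i" t v T] v isCont_G by (auto intro: continuous_at_imp_continuous_on)
    then show "v \<in> G i ` {T<..}" using v by (cases "s = T") auto
  qed
  have "isCont (quantile i) (G i t)" if "t > T" for t
  proof (rule isCont_inverse_function[where f = "G i" and x = t and d = "(t - T) / 2"])
    fix z assume "\<bar>z - t\<bar> \<le> (t - T) / 2"
    then have "t - z \<le> (t - T) / 2" using abs_ge_minus_self[of "z - t"] by linarith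
    then have "z > T" using that by (simp add: field_simps)
    then show "quantile i (G i z) = z" by (rule inv)
  qed (use that isCont_G in auto)
  then have "continuous_on (G i ` {T<..}) (quantile i)"
    by (auto intro!: continuous_at_imp_continuous_on)
  then have "continuous_on {0<..<G i T} (quantile i)" using im by (rule continuous_on_subset)
  moreover have "G i (quantile i v) = v" if "v \<in> {0<..<G i T}" for v
    using im that inv by force
  moreover have "\<forall>\<^sub>F t in at_top. quantile i (G i t) = t"
    using eventually_gt_at_top[of T] by eventually_elim (rule inv)
  ultimately show thesis using that[of "G i T"] G_pos by blast
qed

lemma G_quantile: "\<forall>\<^sub>F v in at_right 0. G i (quantile i v) = v"
proof -
  obtain u0 where "u0 > 0" "\<And>v. v \<in> {0<..<u0} \<Longrightarrow> G i (quantile i v) = v" using quantile[of i] by blast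
  then show ?thesis unfolding eventually_at_right_field by auto
qed

lemma quantile_at_top: "filterlim (quantile i) at_top (at_right 0)"
  unfolding filterlim_at_top
proof
  fix Z
  have "\<forall>\<^sub>F v in at_right 0. v < G i Z"
    using G_pos[of i Z] by (auto simp: eventually_at_right_field)
  with G_quantile[of i] show "\<forall>\<^sub>F v in at_right 0. Z \<le> quantile i v"
  proof eventually_elim
    case (elim v)
    show ?case
    proof (rule ccontr)
      assume "\<not> ?thesis"
      then show False using G_antimono[of "quantile i v" Z i] elim by simp
    qed
  qed
qed

lemma mult_at_right:
  assumes "w > 0"
  shows "filterlim (\<lambda>p. fst p * snd p) (at_right (0::real)) (at_right 0 \<times>\<^sub>F nhds w)"
proof (rule tendsto_imp_filterlim_at_right)
  let ?F = "at_right (0::real) \<times>\<^sub>F nhds w"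
  have u: "(fst \<longlongrightarrow> 0) ?F"
    by (rule filterlim_mono[OF filterlim_fst _ order_refl]) (simp add: at_within_def)
  have w: "(snd \<longlongrightarrow> w) ?F" by (rule filterlim_snd)
  show "((\<lambda>p. fst p * snd p) \<longlongrightarrow> 0) ?F" using tendsto_mult[OF u w] by simp
  have "\<forall>\<^sub>F p in ?F. fst p > 0"
    by (rule eventually_compose_filterlim[OF _ filterlim_fst]) (auto simp: eventually_at_filter)
  then show "\<forall>\<^sub>F p in ?F. fst p * snd p > 0"
    using order_tendstoD(1)[OF w assms] by eventually_elim simp
qed

text \<open>The point with tail \<open>u * w\<close> in margin \<open>i\<close>, in the coordinates centred at the point with tail
  \<open>u\<close> in the first margin.\<close>

definition position :: "'n \<Rightarrow> real \<Rightarrow> real \<Rightarrow> real" where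
  "position i u w = (quantile i (u * w) - quantile first u) / m (quantile first u)"

lemma shift_position: "quantile first u + m (quantile first u) * position i u w = quantile i (u * w)"
  using m_pos[of "quantile first u"] by (simp add: position_def)

text \<open>No expansion of the inverse function is needed. By monotonicity, comparing
  \<open>u * w\<close> with \<open>G i\<close> at displacement \<open>b\<close> tells on which side
  of \<open>b\<close> the position lies, and for a fixed test value \<open>b\<close> the pointwise
  limit \<open>G_rel1\<close> decides this comparison.\<close>

lemma position_tendsto:
  assumes w: "w > 0"
  shows "((\<lambda>p. position i (fst p) (snd p)) \<longlongrightarrow> - ln (w / a $ i)) (at_right 0 \<times>\<^sub>F nhds w)"
proof -
  let ?F = "at_right (0::real) \<times>\<^sub>F nhds w"
  let ?t = "\<lambda>p. quantile first (fst p)"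
  have sw: "(snd \<longlongrightarrow> w) ?F" by (rule filterlim_snd)
  have t: "filterlim ?t at_top ?F" by (rule filterlim_fst_prod[OF quantile_at_top])
  have lim: "((\<lambda>p. snd p - G i (?t p + m (?t p) * b) / G first (?t p)) \<longlongrightarrow> w - a $ i * exp (- b)) ?F" for b
    by (intro tendsto_diff sw filterlim_compose[OF G_rel1 t])
  have e1: "\<forall>\<^sub>F p in ?F. G first (?t p) = fst p"
    by (rule eventually_compose_filterlim[OF G_quantile filterlim_fst])
  have e2: "\<forall>\<^sub>F p in ?F. G i (quantile i (fst p * snd p)) = fst p * snd p"
    by (rule eventually_compose_filterlim[OF G_quantile mult_at_right[OF w]])
  have e3: "\<forall>\<^sub>F p in ?F. fst p > 0"
    by (rule eventually_compose_filterlim[OF _ filterlim_fst]) (auto simp: eventually_at_filter)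
  have conv: "(a $ i * exp (- b) < w) = (- ln (w / a $ i) < b)" "(w < a $ i * exp (- b)) = (b < - ln (w / a $ i))" for b
  proof -
    have "(a $ i * exp (- b) < w) = (exp (- b) < w / a $ i)"
      using a_pos[of i] by (simp add: field_simps)
    also have "\<dots> = (- b < ln (w / a $ i))" using w a_pos[of i] by (metis divide_pos_pos exp_less_cancel_iff exp_ln)
    finally show "(a $ i * exp (- b) < w) = (- ln (w / a $ i) < b)" by auto
    have "(w < a $ i * exp (- b)) = (w / a $ i < exp (- b))"
      using a_pos[of i] by (simp add: field_simps)
    also have "\<dots> = (ln (w / a $ i) < - b)" using w a_pos[of i] by (metis divide_pos_pos exp_less_cancel_iff exp_ln)
    finally show "(w < a $ i * exp (- b)) = (b < - ln (w / a $ i))" by auto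
  qed
  show ?thesis
  proof (rule order_tendstoI)
    fix b assume "b < - ln (w / a $ i)"
    then have "w - a $ i * exp (- b) < 0" using conv(2) by simp
    from order_tendstoD(2)[OF lim this] e1 e2 e3
    show "\<forall>\<^sub>F p in ?F. b < position i (fst p) (snd p)"
    proof eventually_elim
      case (elim p)
      have "G i (quantile i (fst p * snd p)) < G i (?t p + m (?t p) * b)"
        using elim by (simp add: field_simps)
      then have "?t p + m (?t p) * b < quantile i (fst p * snd p)"
        using G_antimono[of "quantile i (fst p * snd p)" "?t p + m (?t p) * b" i] by force
      then show ?case using m_pos[of "?t p"] by (simp add: position_def field_simps)
    qed
  next
    fix b assume "- ln (w / a $ i) < b"
    then have "0 < w - a $ i * exp (- b)" using conv(1) by simp
    from order_tendstoD(1)[OF lim this] e1 e2 e3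
    show "\<forall>\<^sub>F p in ?F. position i (fst p) (snd p) < b"
    proof eventually_elim
      case (elim p)
      have "G i (?t p + m (?t p) * b) < G i (quantile i (fst p * snd p))"
        using elim by (simp add: field_simps)
      then have "quantile i (fst p * snd p) < ?t p + m (?t p) * b"
        using G_antimono[of "?t p + m (?t p) * b" "quantile i (fst p * snd p)" i] by force
      then show ?case using m_pos[of "?t p"] by (simp add: position_def field_simps)
    qed
  qed
qed

end

subsection \<open>The copula density and the joint density\<close>

lemma tendsto_vec_snd: "((\<lambda>p. snd p $ i) \<longlongrightarrow> x $ i) (F \<times>\<^sub>F nhds x)"
  by (rule tendsto_vec_nth) (rule filterlim_snd)

lemma eventually_at_right_pos: "\<forall>\<^sub>F p in at_right (0::real) \<times>\<^sub>F F. 0 < fst p"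
  by (rule eventually_compose_filterlim[OF _ filterlim_fst]) (auto simp: eventually_at_filter)

lemma tendsto_fst_at_right: "(fst \<longlongrightarrow> 0) (at_right (0::real) \<times>\<^sub>F F)"
  by (rule filterlim_mono[OF filterlim_fst _ order_refl]) (simp add: at_within_def)

lemma open_orthant: "open {w :: real ^ 'n::finite. \<forall>i. 0 < w $ i}"
proof -
  have "{w :: real ^ 'n. \<forall>i. 0 < w $ i} = (\<Inter>i. {w. 0 < w $ i})" by auto
  then show ?thesis by (auto intro!: open_INT open_Collect_less continuous_intros)
qed

lemma isCont_vec_lambda: "(\<And>i. isCont (\<lambda>x. g x i) x) \<Longrightarrow> isCont (\<lambda>x. \<chi> i. g x i) x"
  unfolding isCont_def by (rule tendsto_vec_lambda)

text \<open>The transform acts coordinatewise, so its derivative is diagonal with entries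
  \<open>- (a $ i * exp (- x $ i))\<close>. The absolute value of the determinant is the product in
  the hypothesis, and both formulas of the relation reduce to one.\<close>

lemma tail_density_relationI:
  fixes a :: "real ^ 'n::finite"
  assumes a: "\<And>i. 0 < a $ i"
    and lam: "\<And>x. lam x = lamU (exp_transform a x) * (\<Prod>i\<in>UNIV. a $ i * exp (- x $ i))"
  shows "tail_density_relation a lam lamU"
proof -
  have "\<bar>det (jacobian (exp_transform a) (at x))\<bar> = (\<Prod>i\<in>UNIV. a $ i * exp (- x $ i))" for x
  proof -
    let ?D = "\<lambda>h :: real ^ 'n. \<chi> i. - (a $ i * exp (- x $ i)) * h $ i"
    have "(exp_transform a has_derivative ?D) (at x)"
      unfolding exp_transform_def
      by (subst has_derivative_componentwise_within)
        (auto simp: Basis_vec_def inner_axis intro!: derivative_eq_intros bounded_linear_imp_has_derivative bounded_linear_vec_nth)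
    then have "frechet_derivative (exp_transform a) (at x) = ?D"
      using frechet_derivative_at by metis
    then have J: "jacobian (exp_transform a) (at x) = matrix ?D" by (simp add: jacobian_def)
    have "det (matrix ?D) = (\<Prod>i\<in>UNIV. - (a $ i * exp (- x $ i)))"
      by (subst det_diagonal) (auto simp: matrix_def axis_def)
    then show ?thesis unfolding J by (simp add: abs_prod abs_mult a less_imp_le)
  qed
  moreover have "(\<Prod>i\<in>UNIV. a $ i * exp (- x $ i)) = (\<Prod>i\<in>UNIV. a $ i) * exp (- (\<Sum>i\<in>UNIV. x $ i))" for x :: "real ^ 'n"
    by (simp add: prod.distrib exp_sum flip: sum_negf)
  ultimately show ?thesis unfolding tail_density_relation_def by (simp add: lam)
qed

locale copula_density = margins m G fi a first
  for m :: "real \<Rightarrow> real" and G fi :: "'n::finite \<Rightarrow> real \<Rightarrow> real" and a first +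
  fixes c f :: "real ^ 'n \<Rightarrow> real"
  assumes c_cont: "\<exists>U. open U \<and> 1 \<in> U \<and> continuous_on (U \<inter> box 0 1) c"
    and f_eq: "f x = c (\<chi> i. 1 - G i (x $ i)) * (\<Prod>i\<in>UNIV. fi i (x $ i))"
begin

text \<open>Continuity is known only inside the open cube, so each coordinate has to approach 1
  strictly from below.\<close>

lemma isCont_c:
  assumes v: "\<And>i. ((\<lambda>p. v p $ i) \<longlongrightarrow> 1) F" and lt: "\<And>i. \<forall>\<^sub>F p in F. v p $ i < 1"
  shows "\<forall>\<^sub>F p in F. isCont c (v p)"
proof -
  obtain U where U: "open U" "1 \<in> U" "continuous_on (U \<inter> box 0 1) c" using c_cont by blast
  have "(v \<longlongrightarrow> 1) F" using v by (intro vec_tendstoI) simp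
  then have "\<forall>\<^sub>F p in F. v p \<in> U" using U by (intro topological_tendstoD)
  moreover have "\<forall>\<^sub>F p in F. \<forall>i. v p $ i < 1" using lt by (intro eventually_all_finite)
  moreover have "\<forall>\<^sub>F p in F. \<forall>i. 0 < v p $ i" using order_tendstoD(1)[OF v, of 0] by (intro eventually_all_finite) auto
  ultimately show ?thesis
  proof eventually_elim
    case (elim p)
    then have "v p \<in> U \<inter> box 0 1" by (simp add: mem_box_cart)
    moreover have "open (U \<inter> box 0 1)" using U by (intro open_Int open_box)
    ultimately show ?case using U(3) continuous_on_eq_continuous_at by blast
  qed
qed

lemma isCont_f:
  assumes x: "\<And>i. filterlim (\<lambda>p. x p $ i) at_top F"
  shows "\<forall>\<^sub>F p in F. isCont f (x p)"
proof -
  have "\<forall>\<^sub>F p in F. isCont c (\<chi> i. 1 - G i (x p $ i))"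
  proof (rule isCont_c)
    fix i
    show "((\<lambda>p. (\<chi> i. 1 - G i (x p $ i)) $ i) \<longlongrightarrow> 1) F"
      using tendsto_diff[OF tendsto_const filterlim_compose[OF G_0 x], of 1] by simp
  qed (simp add: G_pos)
  then show ?thesis
  proof eventually_elim
    case (elim p)
    have nth: "isCont (\<lambda>y. g (y $ i)) (x p)" if "isCont g (x p $ i)" for g :: "real \<Rightarrow> real" and i
    proof -
      have "isCont (\<lambda>y. y $ i) (x p)" by (intro continuous_intros)
      then show ?thesis using that by (rule isCont_o2)
    qed
    have "isCont (\<lambda>y. \<chi> i. 1 - G i (y $ i)) (x p)"
      by (intro isCont_vec_lambda continuous_intros nth isCont_G)
    then have "isCont (\<lambda>y. c (\<chi> i. 1 - G i (y $ i))) (x p)" using elim by (rule isCont_o2)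
    moreover have "isCont (\<lambda>y. fi i (y $ i)) (x p)" for i
      using fi_cont[of i] by (intro nth) (simp add: continuous_on_eq_continuous_at)
    ultimately show ?case unfolding f_eq[abs_def] by (intro continuous_intros) auto
  qed
qed

text \<open>With \<open>u = G first t\<close> and \<open>w\<close> the vector of tail ratios, the
  \<open>d\<close> marginal densities contribute \<open>(u / m t) ^ d\<close> up to a convergent
  factor. This cancels the \<open>- d\<close> in \<open>u powr (\<kappa> - d)\<close>, leaving
  \<open>m t powr (- d)\<close> and \<open>u powr \<kappa> * l u\<close>, which is
  \<open>V t powr \<kappa>\<close>; hence the form of \<open>scaling\<close>. The limits of the
  marginal factors form the Jacobian.\<close>

lemma copula_to_density:
  assumes \<kappa>: "\<kappa> > 0" and l: "slowly_varying_at_0 l" and c: "copula_upper_tail c \<kappa> l lamU"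
  shows "\<exists>lam. density_upper_tail f m \<kappa> (scaling (G first) l \<kappa>) lam \<and> tail_density_relation a lam lamU"
proof -
  let ?d = "real CARD('n)"
  let ?S = "{w :: real ^ 'n. \<forall>i. 0 < w $ i}"
  define V where "V = scaling (G first) l \<kappa>"
  define q where "q u w = c (\<chi> i. 1 - u * w $ i) / (u powr (\<kappa> - ?d) * l u)" for u w
  have lu: "locally_uniform_limit ?S q lamU (at_right 0)" and pos: "\<And>w. w \<in> ?S \<Longrightarrow> 0 < lamU w"
    using c unfolding copula_upper_tail_def q_def by auto
  have l_pos: "\<forall>\<^sub>F u in at_right 0. 0 < l u" using l unfolding slowly_varying_at_0_def by simp
  have "continuous_on ?S lamU"
  proof (rule locally_uniform_limit_continuous[OF lu _ open_orthant])
    fix w assume w: "w \<in> ?S"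
    let ?F = "at_right 0 \<times>\<^sub>F nhds w"
    have "\<forall>\<^sub>F p in ?F. isCont c (\<chi> i. 1 - fst p * snd p $ i)"
    proof (rule isCont_c)
      fix i
      show "((\<lambda>p. (\<chi> i. 1 - fst p * snd p $ i) $ i) \<longlongrightarrow> 1) ?F"
        using tendsto_diff[OF tendsto_const tendsto_mult[OF tendsto_fst_at_right tendsto_vec_snd], of 1] by simp
      show "\<forall>\<^sub>F p in ?F. (\<chi> i. 1 - fst p * snd p $ i) $ i < 1"
      proof -
        have "\<forall>\<^sub>F p in ?F. 0 < snd p $ i" using w by (intro order_tendstoD(1)[OF tendsto_vec_snd]) simp
        with eventually_at_right_pos show ?thesis by eventually_elim simp
      qed
    qed
    then show "\<forall>\<^sub>F p in ?F. isCont (q (fst p)) (snd p)"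
    proof eventually_elim
      case (elim p)
      have "isCont (\<lambda>w. \<chi> i. 1 - fst p * w $ i) (snd p)" by (intro isCont_vec_lambda continuous_intros)
      from isCont_o2[OF this elim] show ?case unfolding q_def[abs_def] divide_inverse
        by (intro continuous_intros)
    qed
  qed simp
  then have cc: "((\<lambda>p. q (fst p) (snd p)) \<longlongrightarrow> lamU w) (at_right 0 \<times>\<^sub>F nhds w)" if "w \<in> ?S" for w
    using that by (intro locally_uniform_limit_tendsto[OF lu open_orthant])
  define lam where "lam x = lamU (exp_transform a x) * (\<Prod>i\<in>UNIV. a $ i * exp (- x $ i))" for x
  have S: "exp_transform a x \<in> ?S" for x by (simp add: exp_transform_def a_pos)
  have lim: "((\<lambda>p. f (\<chi> i. fst p + m (fst p) * snd p $ i) / (m (fst p) powr (- ?d) * V (fst p) powr \<kappa>)) \<longlongrightarrow> lam x)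
      (at_top \<times>\<^sub>F nhds x)" for x
  proof -
    let ?F = "at_top \<times>\<^sub>F nhds x"
    let ?s = "\<lambda>p i. fst p + m (fst p) * snd p $ i"
    let ?u = "\<lambda>p. G first (fst p)"
    have u: "filterlim ?u (at_right 0) ?F" by (rule filterlim_fst_prod[OF G_at_right])
    have w: "((\<lambda>p. \<chi> i. G i (?s p i) / ?u p) \<longlongrightarrow> exp_transform a x) ?F"
      unfolding exp_transform_def
      by (intro tendsto_vec_lambda tendsto_Pair_compose[OF G_rel] filterlim_fst tendsto_vec_snd)
    have d: "((\<lambda>p. m (fst p) * fi i (?s p i) / ?u p) \<longlongrightarrow> a $ i * exp (- x $ i)) ?F" for i
      by (intro tendsto_Pair_compose[OF density_rel] filterlim_fst tendsto_vec_snd)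
    have "((\<lambda>p. q (?u p) (\<chi> i. G i (?s p i) / ?u p) * (\<Prod>i\<in>UNIV. m (fst p) * fi i (?s p i) / ?u p)) \<longlongrightarrow> lam x) ?F"
      unfolding lam_def by (intro tendsto_mult tendsto_prod d tendsto_Pair_compose[OF cc[OF S] u w])
    moreover have "\<forall>\<^sub>F p in ?F. q (?u p) (\<chi> i. G i (?s p i) / ?u p) * (\<Prod>i\<in>UNIV. m (fst p) * fi i (?s p i) / ?u p)
        = f (\<chi> i. ?s p i) / (m (fst p) powr (- ?d) * V (fst p) powr \<kappa>)"
      using eventually_compose_filterlim[OF l_pos u]
    proof eventually_elim
      case (elim p)
      have G: "?u p > 0" by (rule G_pos)
      have V: "V (fst p) powr \<kappa> = ?u p powr \<kappa> * l (?u p)"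
        unfolding V_def scaling_def using elim G \<kappa> by (simp add: powr_mult powr_powr)
      have P: "(\<Prod>i\<in>UNIV. m (fst p) * fi i (?s p i) / ?u p)
          = m (fst p) powr ?d / ?u p powr ?d * (\<Prod>i\<in>UNIV. fi i (?s p i))"
        using G m_pos[of "fst p"] by (simp add: prod_dividef prod.distrib powr_realpow)
      have f: "f (\<chi> i. ?s p i) = c (\<chi> i. 1 - ?u p * (\<chi> i. G i (?s p i) / ?u p) $ i) * (\<Prod>i\<in>UNIV. fi i (?s p i))"
        using G by (simp add: f_eq)
      \<comment> \<open>Here \<open>A\<close> and \<open>B\<close> are the powers of
        \<open>u\<close> with exponents \<open>\<kappa>\<close> and \<open>d\<close>,
        \<open>M\<close> is the \<open>d\<close>-th power of \<open>m\<close>, \<open>L\<close> is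
        \<open>l u\<close>, and \<open>C\<close> and \<open>P\<close> are the copula density and the
        product of the marginal densities.\<close>
      have *: "C / (A / B * L) * (M / B * P) = C * P / (inverse M * (A * L))"
        if "A \<noteq> 0" "B \<noteq> 0" "L \<noteq> 0" "M \<noteq> 0" for A B C L M P :: real
        using that by (simp add: field_simps)
      show ?case unfolding q_def V P f powr_diff powr_minus
        using elim G m_pos[of "fst p"] by (intro *) auto
    qed
    ultimately show ?thesis by (rule Lim_transform_eventually)
  qed
  have "density_upper_tail f m \<kappa> V lam"
    unfolding density_upper_tail_def
  proof
    show "locally_uniform_limit UNIV (\<lambda>t x. f (\<chi> i. t + m t * x $ i) / (m t powr (- ?d) * V t powr \<kappa>)) lam at_top"
      by (rule tendsto_locally_uniform_limit) (simp_all add: lim)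
    show "\<forall>x. 0 < lam x"
      unfolding lam_def by (intro allI mult_pos_pos prod_pos pos[OF S] ballI a_pos exp_gt_zero)
  qed
  moreover have "tail_density_relation a lam lamU"
    by (rule tail_density_relationI) (simp_all add: a_pos lam_def)
  ultimately show ?thesis unfolding V_def by blast
qed

text \<open>The argument of \<open>l\<close> is multiplied by a ratio that converges but varies with
  \<open>t\<close>, which requires the joint limit \<open>slowly_varying_tendsto\<close>. Then
  \<open>l\<close> contributes a factor tending to 1, and \<open>G first\<close> contributes
  \<open>exp (- x)\<close> because \<open>a $ first = 1\<close>.\<close>

lemma scaling_Gamma:
  assumes \<kappa>: "\<kappa> > 0" and l: "slowly_varying_at_0 l"
  shows "scaling (G first) l \<kappa> \<in> Gamma_minus1 m"
proof -
  have lc: "continuous_on {0<..} l" and l_pos: "\<forall>\<^sub>F u in at_right 0. 0 < l u"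
    using l unfolding slowly_varying_at_0_def by auto
  have G_cont: "continuous_on UNIV (G first)"
    using isCont_G by (auto intro: continuous_at_imp_continuous_on)
  have "continuous_on UNIV (\<lambda>t. l (G first t))"
    by (rule continuous_on_compose2[OF lc G_cont]) (auto simp: G_pos)
  then have [measurable]: "(\<lambda>t. l (G first t)) \<in> borel_measurable borel" "G first \<in> borel_measurable borel"
    using G_cont by (auto intro: borel_measurable_continuous_onI)
  have meas: "scaling (G first) l \<kappa> \<in> borel_measurable borel"
    unfolding scaling_def[abs_def] by measurable
  have pos: "\<forall>\<^sub>F t in at_top. 0 < l (G first t)"
    by (rule eventually_compose_filterlim[OF l_pos G_at_right])
  have "((\<lambda>t. scaling (G first) l \<kappa> (t + m t * x) / scaling (G first) l \<kappa> t) \<longlongrightarrow> exp (- x)) at_top" for x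
  proof -
    have r: "((\<lambda>t. G first (t + m t * x) / G first t) \<longlongrightarrow> exp (- x)) at_top"
      using G_rel1[of first x] a_first by simp
    have "((\<lambda>t. l (G first t * (G first (t + m t * x) / G first t)) / l (G first t)) \<longlongrightarrow> 1) at_top"
      by (rule tendsto_Pair_compose[OF slowly_varying_tendsto[OF l] G_at_right r]) simp
    then have "((\<lambda>t. G first (t + m t * x) / G first t
        * (l (G first t * (G first (t + m t * x) / G first t)) / l (G first t)) powr (1 / \<kappa>))
        \<longlongrightarrow> exp (- x) * 1 powr (1 / \<kappa>)) at_top"
      by (intro tendsto_mult r tendsto_powr tendsto_const) auto
    moreover have "\<forall>\<^sub>F t in at_top. G first (t + m t * x) / G first t
        * (l (G first t * (G first (t + m t * x) / G first t)) / l (G first t)) powr (1 / \<kappa>)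
        = scaling (G first) l \<kappa> (t + m t * x) / scaling (G first) l \<kappa> t"
      using pos eventually_compose_filterlim[OF pos shift_at_top1[of x]]
    proof eventually_elim
      case (elim t)
      then show ?case using G_pos[of first t] by (simp add: scaling_def powr_divide)
    qed
    ultimately show ?thesis by (rule tendsto_transform) simp
  qed
  moreover have "\<forall>\<^sub>F t in at_top. 0 < scaling (G first) l \<kappa> t"
    using pos by eventually_elim (simp add: scaling_def G_pos)
  ultimately show ?thesis using meas unfolding Gamma_minus1_def by blast
qed

end

section \<open>From the joint density back to the copula density\<close>

context copula_density
begin

context
  fixes \<kappa> :: real and V :: "real \<Rightarrow> real" and lam :: "real ^ 'n \<Rightarrow> real"
  assumes \<kappa>: "\<kappa> > 0" and V: "V \<in> Gamma_minus1 m" and density: "density_upper_tail f m \<kappa> V lam"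
begin

lemma V_pos: "\<forall>\<^sub>F t in at_top. 0 < V t"
  using V unfolding Gamma_minus1_def by simp

lemma lam_pos: "0 < lam x"
  using density unfolding density_upper_tail_def by simp

lemma density_locally_uniform:
  "locally_uniform_limit UNIV (\<lambda>t x. f (\<chi> i. t + m t * x $ i) / (m t powr (- real CARD('n)) * V t powr \<kappa>)) lam at_top"
  using density unfolding density_upper_tail_def by simp

lemma lam_continuous: "continuous_on UNIV lam"
proof (rule locally_uniform_limit_continuous[OF density_locally_uniform])
  fix x :: "real ^ 'n"
  let ?F = "at_top \<times>\<^sub>F nhds x"
  have "\<forall>\<^sub>F p in ?F. isCont f (\<chi> i. fst p + m (fst p) * snd p $ i)"
  proof (rule isCont_f)
    fix i
    show "filterlim (\<lambda>p. (\<chi> i. fst p + m (fst p) * snd p $ i) $ i) at_top ?F"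
      using filterlim_compose[OF shift_at_top filterlim_Pair[OF filterlim_fst tendsto_vec_snd]] by simp
  qed
  then show "\<forall>\<^sub>F p in ?F. isCont (\<lambda>x. f (\<chi> i. fst p + m (fst p) * x $ i)
      / (m (fst p) powr (- real CARD('n)) * V (fst p) powr \<kappa>)) (snd p)"
  proof eventually_elim
    case (elim p)
    have "isCont (\<lambda>x. \<chi> i. fst p + m (fst p) * x $ i) (snd p)"
      by (intro isCont_vec_lambda continuous_intros)
    from isCont_o2[OF this elim] show ?case unfolding divide_inverse by (intro continuous_intros)
  qed
qed simp_all

lemma density_tendsto:
  "((\<lambda>p. f (\<chi> i. fst p + m (fst p) * snd p $ i) / (m (fst p) powr (- real CARD('n)) * V (fst p) powr \<kappa>)) \<longlongrightarrow> lam x)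
    (at_top \<times>\<^sub>F nhds x)"
  by (rule locally_uniform_limit_tendsto[OF density_locally_uniform _ lam_continuous]) simp_all

text \<open>\<open>V\<close> is merely measurable, but the continuous density along the diagonal determines it up to
  equivalence; comparing the base points \<open>t\<close> and \<open>t + m t * y\<close> makes its variation uniform.\<close>

lemma V_ratio:
  "((\<lambda>p. V (fst p + m (fst p) * snd p) powr \<kappa> / V (fst p) powr \<kappa>) \<longlongrightarrow> exp (- (\<kappa> * x))) (at_top \<times>\<^sub>F nhds x)"
proof -
  let ?d = "real CARD('n)"
  let ?g = "\<lambda>t y. f (\<chi> i. t + m t * y $ i) / (m t powr (- ?d) * V t powr \<kappa>)"
  let ?F = "at_top \<times>\<^sub>F nhds x"
  let ?s = "\<lambda>p. fst p + m (fst p) * snd p"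
  have A: "((\<lambda>p. ?g (fst p) (\<chi> i. snd p)) \<longlongrightarrow> lam (\<chi> i. x)) ?F"
    by (rule tendsto_Pair_compose[OF density_tendsto filterlim_fst])
      (intro tendsto_vec_lambda filterlim_snd)
  have B: "((\<lambda>p. ?g (?s p) 0) \<longlongrightarrow> lam 0) ?F"
    by (rule tendsto_Pair_compose[OF density_tendsto shift_at_top tendsto_const])
  \<comment> \<open>Both quotients contain \<open>f\<close> at the same diagonal point, so
    \<open>f\<close> cancels and only ratios of \<open>V\<close> and of \<open>m\<close>
    remain.\<close>
  have "((\<lambda>p. ?g (fst p) (\<chi> i. snd p) / ?g (?s p) 0 * (m (?s p) / m (fst p)) powr ?d)
      \<longlongrightarrow> lam (\<chi> i. x) / lam 0 * 1 powr ?d) ?F"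
    using lam_pos[of 0] by (intro tendsto_mult tendsto_divide A B tendsto_powr tendsto_const m_ratio) auto
  moreover have "\<forall>\<^sub>F p in ?F. ?g (fst p) (\<chi> i. snd p) / ?g (?s p) 0 * (m (?s p) / m (fst p)) powr ?d
      = V (?s p) powr \<kappa> / V (fst p) powr \<kappa>"
    using order_tendstoD(1)[OF B lam_pos] eventually_compose_filterlim[OF V_pos filterlim_fst]
      eventually_compose_filterlim[OF V_pos shift_at_top]
  proof eventually_elim
    case (elim p)
    have *: "F / (inverse M * P) / (F / (inverse N * Q)) * (N / M) = Q / P"
      if "F \<noteq> 0" "M \<noteq> 0" "N \<noteq> 0" "P \<noteq> 0" "Q \<noteq> 0" for F M N P Q :: real
      using that by (simp add: field_simps)
    have "(m (?s p) / m (fst p)) powr ?d = m (?s p) powr ?d / m (fst p) powr ?d"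
      by (rule powr_divide)
    moreover have "f (\<chi> i. ?s p) \<noteq> 0" using elim(1) by auto
    ultimately show ?case
      using * elim m_pos[of "fst p"] m_pos[of "?s p"] by (simp add: powr_minus)
  qed
  ultimately have lim: "((\<lambda>p. V (?s p) powr \<kappa> / V (fst p) powr \<kappa>) \<longlongrightarrow> lam (\<chi> i. x) / lam 0) ?F"
    by (rule tendsto_transform) simp
  from tendsto_Pair_compose[of "\<lambda>t y. V (t + m t * y) powr \<kappa> / V t powr \<kappa>", OF this filterlim_ident tendsto_const]
  have 1: "((\<lambda>t. V (t + m t * x) powr \<kappa> / V t powr \<kappa>) \<longlongrightarrow> lam (\<chi> i. x) / lam 0) at_top" .
  have "((\<lambda>t. (V (t + m t * x) / V t) powr \<kappa>) \<longlongrightarrow> exp (- x) powr \<kappa>) at_top"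
    using V by (intro tendsto_powr tendsto_const) (auto simp: Gamma_minus1_def)
  moreover have "\<forall>\<^sub>F t in at_top. (V (t + m t * x) / V t) powr \<kappa> = V (t + m t * x) powr \<kappa> / V t powr \<kappa>"
    using V_pos eventually_compose_filterlim[OF V_pos shift_at_top1[of x]]
    by eventually_elim (simp add: powr_divide)
  ultimately have "((\<lambda>t. V (t + m t * x) powr \<kappa> / V t powr \<kappa>) \<longlongrightarrow> exp (- (\<kappa> * x))) at_top"
    by (rule tendsto_transform) (simp add: powr_def)
  \<comment> \<open>The joint limit exists with the value \<open>lam (\<chi> i. x) / lam 0\<close>;
    the pointwise property of \<open>V\<close> at the fixed \<open>x\<close> identifies it.\<close>
  from tendsto_unique[OF trivial_limit_at_top_linorder 1 this] lim show ?thesis by simp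
qed

text \<open>The mass of the cube at \<open>(t, \<dots>, t)\<close> with side \<open>m t\<close>, which is comparable to \<open>V t powr \<kappa>\<close>, is at
  most the tail of the first margin. For \<open>\<kappa> < 1\<close> the former decays more slowly than the latter.\<close>

lemma exponent_ge_1:
  assumes cube: "\<And>t h b. 0 < h \<Longrightarrow> 0 \<le> b \<Longrightarrow> (\<And>x. x \<in> box (\<chi> i. t) (\<chi> i. t + h) \<Longrightarrow> b \<le> f x)
      \<Longrightarrow> b * h powr real CARD('n) \<le> G first t"
  shows "1 \<le> \<kappa>"
proof (rule ccontr)
  assume "\<not> 1 \<le> \<kappa>"
  let ?d = "real CARD('n)"
  let ?K = "cbox (0 :: real ^ 'n) 1"
  let ?g = "\<lambda>t y. f (\<chi> i. t + m t * y $ i) / (m t powr (- ?d) * V t powr \<kappa>)"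
  have "?K \<noteq> {}" by (auto simp: interval_eq_empty_cart)
  then obtain x0 where x0: "x0 \<in> ?K" "\<And>x. x \<in> ?K \<Longrightarrow> lam x0 \<le> lam x"
    using continuous_attains_inf[OF compact_cbox _ continuous_on_subset[OF lam_continuous subset_UNIV], of 0 1]
    by blast
  \<comment> \<open>Half the minimum of \<open>lam\<close> on the unit cube: an error below
    \<open>e\<close> leaves the normalized density above \<open>e\<close> throughout the
    cube.\<close>
  define e where "e = lam x0 / 2"
  have e: "e > 0" using lam_pos[of x0] by (simp add: e_def)
  have "uniform_limit ?K ?g lam at_top"
    using density_locally_uniform unfolding locally_uniform_limit_def by simp
  then have "\<forall>\<^sub>F t in at_top. \<forall>x\<in>?K. dist (?g t x) (lam x) < e"
    using e unfolding uniform_limit_iff by blast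
  then have bd: "\<forall>\<^sub>F t in at_top. V t powr \<kappa> / G first t \<le> 1 / e"
    using V_pos
  proof eventually_elim
    case (elim t)
    let ?b = "e * (m t powr (- ?d) * V t powr \<kappa>)"
    have mt: "m t > 0" by (rule m_pos)
    have den: "m t powr (- ?d) * V t powr \<kappa> > 0" using mt elim(2) by simp
    have "?b * m t powr ?d \<le> G first t"
    proof (rule cube)
      show "0 \<le> ?b" using e by simp
      fix y :: "real ^ 'n" assume y: "y \<in> box (\<chi> i. t) (\<chi> i. t + m t)"
      define x where "x = (\<chi> i. (y $ i - t) / m t)"
      have "x \<in> ?K" using y mt by (auto simp: x_def mem_box_cart field_simps less_imp_le)
      then have "dist (?g t x) (lam x) < e" "2 * e \<le> lam x" using elim(1) x0(2) by (auto simp: e_def)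
      then have "e \<le> ?g t x" by (simp add: dist_real_def)
      then have "?b \<le> f (\<chi> i. t + m t * x $ i)" using den by (simp add: pos_le_divide_eq)
      also have "(\<chi> i. t + m t * x $ i) = y" using mt by (simp add: x_def vec_eq_iff)
      finally show "?b \<le> f y" .
    qed (rule mt)
    moreover have "?b * m t powr ?d = e * V t powr \<kappa>"
    proof -
      have "m t powr (- ?d) * m t powr ?d = 1" using mt by (simp flip: powr_add)
      then show ?thesis by (simp add: mult.assoc mult.left_commute)
    qed
    ultimately have "e * V t powr \<kappa> \<le> G first t" by simp
    then show ?case using e G_pos[of first t] by (simp add: field_simps)
  qed
  have pos: "\<forall>\<^sub>F t in at_top. 0 < V t powr \<kappa> / G first t"
    using V_pos by eventually_elim (simp add: G_pos)
  have "((\<lambda>t. V (t + m t * 1) powr \<kappa> / V t powr \<kappa>) \<longlongrightarrow> exp (- (\<kappa> * 1))) at_top"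
    by (rule tendsto_Pair_compose[OF V_ratio filterlim_ident tendsto_const])
  moreover have "((\<lambda>t. G first (t + m t * 1) / G first t) \<longlongrightarrow> a $ first * exp (- 1)) at_top"
    by (rule G_rel1)
  ultimately have "((\<lambda>t. V (t + m t * 1) powr \<kappa> / V t powr \<kappa> / (G first (t + m t * 1) / G first t))
      \<longlongrightarrow> exp (- (\<kappa> * 1)) / (a $ first * exp (- 1))) at_top"
    by (rule tendsto_divide) (simp add: a_first)
  then have "((\<lambda>t. V (t + m t) powr \<kappa> / G first (t + m t) / (V t powr \<kappa> / G first t)) \<longlongrightarrow> exp (1 - \<kappa>)) at_top"
    by (rule tendsto_transform) (auto simp: a_first exp_diff exp_minus field_simps)
  from growth_unbounded[OF pos this _ bd] show False using \<open>\<not> 1 \<le> \<kappa>\<close> by simp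
qed

text \<open>Passing from \<open>u\<close> to \<open>u * x\<close> displaces the quantile by about
  \<open>- ln x\<close> units of \<open>m\<close>. By \<open>V_ratio\<close> this multiplies
  \<open>V powr \<kappa>\<close> by about \<open>x powr \<kappa>\<close>, the same factor as for
  \<open>G first powr \<kappa>\<close>, so their quotient varies slowly in \<open>u\<close>.\<close>

lemma relative_ratio:
  assumes x: "x > 0"
  shows "((\<lambda>u. V (quantile first (u * x)) powr \<kappa> / G first (quantile first (u * x)) powr \<kappa>
      / (V (quantile first u) powr \<kappa> / G first (quantile first u) powr \<kappa>)) \<longlongrightarrow> 1) (at_right 0)"
proof -
  have pos: "((\<lambda>u. position first u x) \<longlongrightarrow> - ln (x / a $ first)) (at_right 0)"
    by (rule tendsto_Pair_compose[OF position_tendsto[OF x] filterlim_ident tendsto_const])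
  have ux: "filterlim (\<lambda>u. u * x) (at_right 0) (at_right 0)"
    by (rule filterlim_compose[OF mult_at_right[OF x] filterlim_Pair[OF filterlim_ident tendsto_const], simplified])
  have "((\<lambda>u. V (quantile first (u * x)) powr \<kappa> / V (quantile first u) powr \<kappa>) \<longlongrightarrow> exp (- (\<kappa> * - ln (x / a $ first)))) (at_right 0)"
    using tendsto_Pair_compose[OF V_ratio quantile_at_top[of first] pos] unfolding shift_position .
  from tendsto_mult[OF this tendsto_const[of "x powr (- \<kappa>)"]]
  have "((\<lambda>u. V (quantile first (u * x)) powr \<kappa> / V (quantile first u) powr \<kappa> * x powr (- \<kappa>)) \<longlongrightarrow>
      exp (- (\<kappa> * - ln (x / a $ first))) * x powr (- \<kappa>)) (at_right 0)" .
  moreover have "\<forall>\<^sub>F u in at_right 0. V (quantile first (u * x)) powr \<kappa> / V (quantile first u) powr \<kappa> * x powr (- \<kappa>)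
      = V (quantile first (u * x)) powr \<kappa> / G first (quantile first (u * x)) powr \<kappa>
      / (V (quantile first u) powr \<kappa> / G first (quantile first u) powr \<kappa>)"
    using G_quantile[of first] eventually_compose_filterlim[OF G_quantile[of first] ux] eventually_at_right_less[of 0]
  proof eventually_elim
    case (elim u)
    then show ?case using x by (simp add: powr_mult powr_minus field_simps)
  qed
  ultimately show ?thesis
  proof (rule tendsto_transform)
    show "exp (- (\<kappa> * - ln (x / a $ first))) * x powr (- \<kappa>) = 1"
      using x by (simp add: a_first powr_def flip: exp_add)
  qed
qed

text \<open>The natural candidate, \<open>V powr \<kappa> / G first powr \<kappa>\<close> at the
  quantile of \<open>u\<close>, varies slowly but need not be continuous. It is replaced by an
  equivalent function with continuous ingredients.\<close>

lemma slowly_varying_exists: "\<exists>l. slowly_varying_at_0 l \<and> tail_equiv V (scaling (G first) l \<kappa>)"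
proof -
  let ?d = "CARD('n)"
  let ?q = "quantile first"
  define R where "R t = V t powr \<kappa> / G first t powr \<kappa>" for t
  \<comment> \<open>Convergence at the origin says that \<open>V t powr \<kappa>\<close> is
    equivalent to \<open>f\<close> on the diagonal times \<open>m t ^ d / lam 0\<close>. As
    \<open>m\<close> need not be continuous either, \<open>G_tail\<close> is used to put
    \<open>G first / fi first\<close> in its place.\<close>
  define W where "W t = f (\<chi> i. t) / lam 0 * (G first t / fi first t) ^ ?d / G first t powr \<kappa>" for t
  have R_pos: "\<forall>\<^sub>F t in at_top. R t > 0"
    using V_pos by eventually_elim (use G_pos in \<open>simp add: R_def less_imp_neq[THEN not_sym]\<close>)
  have WR: "((\<lambda>t. W t / R t) \<longlongrightarrow> 1) at_top"
  proof -
    have "((\<lambda>t. f (\<chi> i. t + m t * (0 :: real ^ 'n) $ i) / (m t powr (- real ?d) * V t powr \<kappa>)) \<longlongrightarrow> lam 0) at_top"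
      by (rule tendsto_Pair_compose[OF density_tendsto filterlim_ident tendsto_const])
    then have "((\<lambda>t. f (\<chi> i. t + m t * (0 :: real ^ 'n) $ i) / (m t powr (- real ?d) * V t powr \<kappa>) / lam 0
        * (G first t / (m t * fi first t)) ^ ?d) \<longlongrightarrow> lam 0 / lam 0 * 1 ^ ?d) at_top"
      using lam_pos[of 0] by (intro tendsto_mult tendsto_divide tendsto_const tendsto_power G_tail) auto
    moreover have "\<forall>\<^sub>F t in at_top. f (\<chi> i. t + m t * (0 :: real ^ 'n) $ i) / (m t powr (- real ?d) * V t powr \<kappa>) / lam 0
        * (G first t / (m t * fi first t)) ^ ?d = W t / R t"
      using V_pos fi_pos[of first]
    proof eventually_elim
      case (elim t)
      have "m t powr (- real ?d) = inverse (m t ^ ?d)" using m_pos[of t] by (simp add: powr_minus powr_realpow)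
      moreover have "G first t powr \<kappa> \<noteq> 0" using G_pos[of first t] by simp
      ultimately show ?case
        using m_pos[of t] elim by (simp add: W_def R_def power_divide power_mult_distrib)
    qed
    ultimately show ?thesis by (rule tendsto_transform) (use lam_pos[of 0] in simp)
  qed
  have W_pos: "\<forall>\<^sub>F t in at_top. W t > 0"
    using order_tendstoD(1)[OF WR zero_less_one] R_pos by eventually_elim (simp add: zero_less_divide_iff)
  have "\<forall>\<^sub>F t in at_top. isCont f (\<chi> i. t)"
    by (rule isCont_f) (simp add: filterlim_ident)
  with fi_pos[of first] have "\<forall>\<^sub>F t in at_top. isCont f (\<chi> i. t) \<and> 0 < fi first t" by eventually_elim simp
  then obtain T where T: "\<And>t. t \<ge> T \<Longrightarrow> isCont f (\<chi> i. t) \<and> 0 < fi first t"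
    unfolding eventually_at_top_linorder by blast
  have W_cont: "continuous_on {T..} W"
  proof -
    have "isCont (\<lambda>t. f (\<chi> i. t)) t" if "t \<ge> T" for t
    proof -
      have "isCont (\<lambda>t. (\<chi> i. t) :: real ^ 'n) t" by (intro isCont_vec_lambda continuous_intros)
      then show ?thesis by (rule isCont_o2) (use T that in blast)
    qed
    then have "continuous_on {T..} (\<lambda>t. f (\<chi> i. t))" by (intro continuous_at_imp_continuous_on) auto
    moreover have "continuous_on {T..} (G first)" using isCont_G by (intro continuous_at_imp_continuous_on) auto
    moreover have "continuous_on {T..} (fi first)" using fi_cont by (rule continuous_on_subset) simp
    ultimately show ?thesis unfolding W_def using lam_pos[of 0] T G_pos
      by (intro continuous_intros) (auto simp: less_imp_neq[THEN not_sym])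
  qed
  obtain u0 where u0: "u0 > 0" "continuous_on {0<..<u0} ?q" and q_inv: "\<forall>\<^sub>F t in at_top. ?q (G first t) = t"
    using quantile[of first] by blast
  have "\<forall>\<^sub>F v in at_right 0. T \<le> ?q v"
    using quantile_at_top[of first] unfolding filterlim_at_top by blast
  then obtain b where b: "b > 0" "\<And>v. 0 < v \<Longrightarrow> v < b \<Longrightarrow> T \<le> ?q v"
    unfolding eventually_at_right_field by blast
  define u1 where "u1 = min (u0 / 2) (b / 2)"
  have u1: "0 < u1" "u1 < u0" "u1 < b" using u0 b by (auto simp: u1_def)
  \<comment> \<open>Freezing the argument at \<open>u1\<close> makes \<open>l\<close> continuous on
    the whole half-line: up to \<open>u1\<close> the quantile is continuous and at least
    \<open>T\<close>, where \<open>W\<close> is continuous. The behaviour at 0 does not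
    change.\<close>
  define l where "l u = W (?q (min u u1))" for u
  have small: "\<forall>\<^sub>F u in at_right 0. u < u1"
    using u1 by (auto simp: eventually_at_right_field)
  have l_eq: "\<forall>\<^sub>F u in at_right 0. l u = W (?q u)"
    using small by eventually_elim (simp add: l_def min_def)
  have "slowly_varying_at_0 l"
    unfolding slowly_varying_at_0_def
  proof (intro conjI allI impI)
    have "continuous_on {0<..} (\<lambda>u. ?q (min u u1))"
      by (rule continuous_on_compose2[OF u0(2)]) (use u1 in \<open>auto intro!: continuous_intros\<close>)
    then show "continuous_on {0<..} l"
      unfolding l_def by (rule continuous_on_compose2[OF W_cont]) (use u1 b in auto)
    show "\<forall>\<^sub>F u in at_right 0. 0 < l u"
      using l_eq eventually_compose_filterlim[OF W_pos quantile_at_top[of first]] by eventually_elim simp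
    fix x :: real assume x: "x > 0"
    have ux: "filterlim (\<lambda>u. u * x) (at_right 0) (at_right 0)"
      by (rule filterlim_compose[OF mult_at_right[OF x] filterlim_Pair[OF filterlim_ident tendsto_const], simplified])
    have q: "filterlim (\<lambda>u. ?q (u * x)) at_top (at_right 0)"
      by (rule filterlim_compose[OF quantile_at_top ux])
    have "((\<lambda>u. (W (?q (u * x)) / R (?q (u * x))) / (W (?q u) / R (?q u)) * (R (?q (u * x)) / R (?q u))) \<longlongrightarrow> 1 / 1 * 1) (at_right 0)"
      using relative_ratio[OF x, folded R_def]
      by (intro tendsto_mult tendsto_divide filterlim_compose[OF WR q] filterlim_compose[OF WR quantile_at_top]) auto
    moreover have "\<forall>\<^sub>F u in at_right 0. (W (?q (u * x)) / R (?q (u * x))) / (W (?q u) / R (?q u)) * (R (?q (u * x)) / R (?q u))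
        = l (u * x) / l u"
      using l_eq eventually_compose_filterlim[OF l_eq ux] eventually_compose_filterlim[OF R_pos q]
        eventually_compose_filterlim[OF R_pos quantile_at_top[of first]]
      by eventually_elim simp
    ultimately show "((\<lambda>u. l (u * x) / l u) \<longlongrightarrow> 1) (at_right 0)" by (rule tendsto_transform) simp
  qed
  moreover have "tail_equiv V (scaling (G first) l \<kappa>)"
    unfolding tail_equiv_def
  proof -
    have "((\<lambda>t. inverse (W t / R t) powr (1 / \<kappa>)) \<longlongrightarrow> inverse 1 powr (1 / \<kappa>)) at_top"
      by (intro tendsto_powr tendsto_inverse WR tendsto_const) auto
    moreover have "\<forall>\<^sub>F t in at_top. inverse (W t / R t) powr (1 / \<kappa>) = V t / scaling (G first) l \<kappa> t"
      using eventually_compose_filterlim[OF l_eq G_at_right[of first]] q_inv W_pos V_pos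
    proof eventually_elim
      case (elim t)
      have "inverse (W t / R t) powr (1 / \<kappa>) = V t / (G first t * W t powr (1 / \<kappa>))"
        using elim G_pos[of first t] \<kappa> unfolding R_def
        by (simp add: powr_divide powr_mult powr_powr)
      then show ?case using elim by (simp add: scaling_def)
    qed
    ultimately show "((\<lambda>t. V t / scaling (G first) l \<kappa> t) \<longlongrightarrow> 1) at_top" by (rule tendsto_transform) simp
  qed
  ultimately show ?thesis by blast
qed

text \<open>Only \<open>V\<close> up to equivalence enters the limit, so any slowly varying
  \<open>l\<close> with matching scaling will do. The base point is the quantile of
  \<open>u\<close>, and \<open>position\<close> supplies the arguments at which the margins have
  tails \<open>u * w $ i\<close>.\<close>

lemma density_to_copula:
  assumes l: "slowly_varying_at_0 l" and eq: "tail_equiv V (scaling (G first) l \<kappa>)"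
  shows "\<exists>lamU. copula_upper_tail c \<kappa> l lamU \<and> tail_density_relation a lam lamU"
proof -
  let ?d = "real CARD('n)"
  let ?S = "{w :: real ^ 'n. \<forall>i. 0 < w $ i}"
  have l_pos: "\<forall>\<^sub>F u in at_right 0. 0 < l u" using l unfolding slowly_varying_at_0_def by simp
  \<comment> \<open>The inverse transform solves \<open>w $ i = a $ i * exp (- x $ i)\<close>; the
    product of the \<open>w $ i\<close> is the absolute Jacobian there.\<close>
  define lamU where "lamU w = lam (\<chi> i. - ln (w $ i / a $ i)) / (\<Prod>i\<in>UNIV. w $ i)" for w
  have VG: "((\<lambda>t. V t powr \<kappa> / (G first t powr \<kappa> * l (G first t))) \<longlongrightarrow> 1) at_top"
  proof -
    have "((\<lambda>t. (V t / scaling (G first) l \<kappa> t) powr \<kappa>) \<longlongrightarrow> 1 powr \<kappa>) at_top"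
      using eq unfolding tail_equiv_def by (intro tendsto_powr tendsto_const) auto
    moreover have "\<forall>\<^sub>F t in at_top. (V t / scaling (G first) l \<kappa> t) powr \<kappa> = V t powr \<kappa> / (G first t powr \<kappa> * l (G first t))"
      using V_pos eventually_compose_filterlim[OF l_pos G_at_right[of first]]
      by eventually_elim (use G_pos \<kappa> in \<open>simp add: scaling_def powr_divide powr_mult powr_powr less_imp_le\<close>)
    ultimately show ?thesis by (rule tendsto_transform) simp
  qed
  have lim: "((\<lambda>p. c (\<chi> i. 1 - fst p * snd p $ i) / (fst p powr (\<kappa> - ?d) * l (fst p))) \<longlongrightarrow> lamU w) (at_right 0 \<times>\<^sub>F nhds w)"
    if "w \<in> ?S" for w
  proof -
    have w: "w $ i > 0" for i using that by simp
    let ?F = "at_right 0 \<times>\<^sub>F nhds w"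
    let ?t = "\<lambda>p. quantile first (fst p)"
    let ?y = "\<lambda>p i. position i (fst p) (snd p $ i)"
    let ?s = "\<lambda>p i. ?t p + m (?t p) * ?y p i"
    let ?z = "\<lambda>i. - ln (w $ i / a $ i)"
    have t: "filterlim ?t at_top ?F" by (rule filterlim_fst_prod[OF quantile_at_top])
    have y: "((\<lambda>p. ?y p i) \<longlongrightarrow> ?z i) ?F" for i
      by (rule tendsto_Pair_compose[OF position_tendsto[OF w] filterlim_fst tendsto_vec_snd])
    have uw: "filterlim (\<lambda>p. fst p * snd p $ i) (at_right 0) ?F" for i
      using filterlim_compose[OF mult_at_right[OF w] filterlim_Pair[OF filterlim_fst tendsto_vec_snd]] by simp
    have g: "((\<lambda>p. f (\<chi> i. ?t p + m (?t p) * (\<chi> i. ?y p i) $ i) / (m (?t p) powr (- ?d) * V (?t p) powr \<kappa>)) \<longlongrightarrow> lam (\<chi> i. ?z i)) ?F"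
      by (rule tendsto_Pair_compose[OF density_tendsto t]) (intro tendsto_vec_lambda y)
    have d: "((\<lambda>p. m (?t p) * fi i (?s p i) / G first (?t p)) \<longlongrightarrow> a $ i * exp (- ?z i)) ?F" for i
      by (rule tendsto_Pair_compose[OF density_rel t y])
    have z: "a $ i * exp (- ?z i) = w $ i" for i using w a_pos[of i] by simp
    have "((\<lambda>p. f (\<chi> i. ?t p + m (?t p) * (\<chi> i. ?y p i) $ i) / (m (?t p) powr (- ?d) * V (?t p) powr \<kappa>)
        / (\<Prod>i\<in>UNIV. m (?t p) * fi i (?s p i) / G first (?t p))
        * (V (?t p) powr \<kappa> / (G first (?t p) powr \<kappa> * l (G first (?t p)))))
        \<longlongrightarrow> lam (\<chi> i. ?z i) / (\<Prod>i\<in>UNIV. a $ i * exp (- ?z i)) * 1) ?F"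
      by (intro tendsto_mult tendsto_divide g tendsto_prod d filterlim_compose[OF VG t])
        (simp add: a_pos less_imp_neq[THEN not_sym])
    moreover have "\<forall>\<^sub>F p in ?F. f (\<chi> i. ?t p + m (?t p) * (\<chi> i. ?y p i) $ i) / (m (?t p) powr (- ?d) * V (?t p) powr \<kappa>)
        / (\<Prod>i\<in>UNIV. m (?t p) * fi i (?s p i) / G first (?t p))
        * (V (?t p) powr \<kappa> / (G first (?t p) powr \<kappa> * l (G first (?t p))))
        = c (\<chi> i. 1 - fst p * snd p $ i) / (fst p powr (\<kappa> - ?d) * l (fst p))"
    proof -
      have e1: "\<forall>\<^sub>F p in ?F. G first (?t p) = fst p"
        by (rule eventually_compose_filterlim[OF G_quantile filterlim_fst])
      have e2: "\<forall>\<^sub>F p in ?F. \<forall>i. G i (quantile i (fst p * snd p $ i)) = fst p * snd p $ i"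
        by (intro eventually_all_finite eventually_compose_filterlim[OF G_quantile uw])
      have e3: "\<forall>\<^sub>F p in ?F. \<forall>i. 0 < fi i (quantile i (fst p * snd p $ i))"
        by (intro eventually_all_finite eventually_compose_filterlim[OF fi_pos] filterlim_compose[OF quantile_at_top uw])
      have e4: "\<forall>\<^sub>F p in ?F. 0 < V (?t p)" by (rule eventually_compose_filterlim[OF V_pos t])
      show ?thesis using e1 e2 e3 e4 eventually_at_right_pos[of "nhds w"]
      proof eventually_elim
        case (elim p)
        let ?P = "\<Prod>i\<in>UNIV. fi i (quantile i (fst p * snd p $ i))"
        have f: "f (\<chi> i. ?t p + m (?t p) * (\<chi> i. ?y p i) $ i) = c (\<chi> i. 1 - fst p * snd p $ i) * ?P"
          using elim(2) by (simp add: f_eq shift_position)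
        have P: "(\<Prod>i\<in>UNIV. m (?t p) * fi i (?s p i) / G first (?t p)) = m (?t p) powr ?d / fst p powr ?d * ?P"
          using elim(1,5) m_pos[of "?t p"]
          by (simp add: shift_position prod_dividef prod.distrib powr_realpow)
        have P0: "?P \<noteq> 0" using elim(3) by (simp add: less_imp_neq[THEN not_sym])
        have *: "C * P / (inverse M * Q) / (M / B * P) * (Q / (A * L)) = C / (A / B * L)"
          if "P \<noteq> 0" "Q \<noteq> 0" "M \<noteq> 0" "B \<noteq> 0" for A B C L M P Q :: real
          using that by (simp add: field_simps)
        show ?case unfolding f P unfolding elim(1) powr_diff powr_minus
          using elim(4,5) m_pos[of "?t p"] by (intro * P0) auto
      qed
    qed
    ultimately show ?thesis
      by (rule tendsto_transform) (simp only: lamU_def z mult_1_right)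
  qed
  have "copula_upper_tail c \<kappa> l lamU"
    unfolding copula_upper_tail_def
  proof
    show "locally_uniform_limit ?S (\<lambda>u w. c (\<chi> i. 1 - u * w $ i) / (u powr (\<kappa> - ?d) * l u)) lamU (at_right 0)"
      by (rule tendsto_locally_uniform_limit) (use lim in \<open>simp_all add: trivial_limit_at_right_real\<close>)
    show "\<forall>w. (\<forall>i. 0 < w $ i) \<longrightarrow> 0 < lamU w"
      unfolding lamU_def by (auto intro!: divide_pos_pos lam_pos prod_pos)
  qed
  moreover have "tail_density_relation a lam lamU"
  proof (rule tail_density_relationI)
    fix x :: "real ^ 'n"
    have "- ln (a $ i * exp (- x $ i) / a $ i) = x $ i" for i using a_pos[of i] by simp
    moreover have "(\<Prod>i\<in>UNIV. a $ i * exp (- x $ i)) \<noteq> 0" by (simp add: a_pos less_imp_neq[THEN not_sym])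
    ultimately show "lam x = lamU (exp_transform a x) * (\<Prod>i\<in>UNIV. a $ i * exp (- x $ i))"
      unfolding lamU_def exp_transform_def by (simp add: vec_lambda_eta)
  qed (rule a_pos)
  ultimately show ?thesis by blast
qed

end

end

subsection \<open>Distribution functions and densities\<close>

text \<open>Near \<open>t\<close> the distribution function differs by a constant from an
  antiderivative of the continuous density.\<close>

lemma cdf_density_has_real_derivative:
  assumes M: "real_distribution M" and g: "has_density M g" and cont: "continuous_on UNIV g"
  shows "(cdf M has_real_derivative g t) (at t)"
proof -
  interpret real_distribution M by (rule M)
  have g_meas: "g \<in> borel_measurable borel" and g_nonneg: "\<And>x. 0 \<le> g x" and Mg: "M = density lborel (\<lambda>x. ennreal (g x))"
    using g unfolding has_density_def by auto
  \<comment> \<open>Wider than the interval of comparison, so that \<open>H\<close> is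
    differentiable from both sides at \<open>t - 1\<close>, where the integration starts.\<close>
  let ?I = "{t - 2..t + 2}"
  obtain H where H: "\<And>x. x \<in> ?I \<Longrightarrow> (H has_vector_derivative g x) (at x within ?I)"
    using antiderivative_continuous[OF continuous_on_subset[OF cont subset_UNIV]] by blast
  have DH: "(H has_real_derivative g x) (at x)" if "t - 2 < x" "x < t + 2" for x
    using H[of x] at_within_Icc_at[of "t - 2" x "t + 2"] that
    by (simp add: has_real_derivative_iff_has_vector_derivative)
  have meas: "measure M {t - 1..s} = H s - H (t - 1)" if s: "t - 1 \<le> s" "s \<le> t + 1" for s
  proof -
    have DH': "(H has_real_derivative g x) (at x)" if "t - 1 \<le> x" "x \<le> s" for x
      using DH[of x] that s by simp
    have "emeasure M {t - 1..s} = (\<integral>\<^sup>+x. ennreal (g x) * indicator {t - 1..s} x \<partial>lborel)"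
      unfolding Mg using g_meas by (subst emeasure_density) auto
    also have "\<dots> = ennreal (H s - H (t - 1))"
      by (rule nn_integral_FTC_Icc[OF g_meas _ g_nonneg s(1)]) (use DH' in auto)
    finally have *: "emeasure M {t - 1..s} = ennreal (H s - H (t - 1))" .
    have "H (t - 1) \<le> H s"
      using DERIV_nonneg_imp_nondecreasing[OF s(1), of H] DH' g_nonneg by blast
    with * show ?thesis by (simp add: measure_def)
  qed
  have cdf: "cdf M s = cdf M (t - 1) + (H s - H (t - 1))" if s: "s \<in> {t - 1<..<t + 1}" for s
  proof -
    \<comment> \<open>The integral gives the mass of a closed interval, differences of
      \<open>cdf\<close> that of a left-open one; the case \<open>s = t - 1\<close> shows that the
      endpoint carries no mass.\<close>
    have "measure M {t - 1} = 0" using meas[of "t - 1"] by simp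
    moreover have "{t - 1..s} = {t - 1} \<union> {t - 1<..s}" using s by auto
    ultimately have "measure M {t - 1..s} = measure M {t - 1<..s}"
      by (simp only:) (subst finite_measure_Union, auto)
    then show ?thesis using s meas[of s] cdf_diff_eq[of "t - 1" s] by simp
  qed
  have "((\<lambda>s. cdf M (t - 1) + (H s - H (t - 1))) has_real_derivative g t) (at t)"
    using DH[of t] by (auto intro!: derivative_eq_intros)
  then show ?thesis
    by (rule has_field_derivative_transform_within_open[of _ _ _ "{t - 1<..<t + 1}"]) (use cdf in auto)
qed

text \<open>The cube lies in the half-space where coordinate \<open>i\<close> exceeds
  \<open>t\<close>, and the mass of this half-space is the tail.\<close>

lemma cube_mass_le_tail:
  fixes M :: "(real ^ 'n::finite) measure"
  assumes M: "prob_space M" and f: "has_density M f" and h: "0 < h" and b: "0 \<le> b"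
    and le: "\<And>x. x \<in> box (\<chi> i. t) (\<chi> i. t + h) \<Longrightarrow> b \<le> f x"
  shows "b * h powr real CARD('n) \<le> tail M i t"
proof -
  interpret prob_space M by (rule M)
  have f_meas: "f \<in> borel_measurable borel" and Mf: "M = density lborel (\<lambda>x. ennreal (f x))"
    using f unfolding has_density_def by auto
  have [measurable_cong]: "sets M = sets borel" unfolding Mf by simp
  have space: "space M = UNIV" unfolding Mf by simp
  let ?B = "box (\<chi> i. t) (\<chi> i. t + h) :: (real ^ 'n) set"
  have comp: "(\<lambda>x :: real ^ 'n. x $ i) \<in> borel_measurable borel" by (intro borel_measurable_continuous_onI continuous_intros)
  have "ennreal (b * h powr real CARD('n)) = ennreal b * emeasure lborel ?B"
  proof -
    have "emeasure lborel ?B = ennreal (h powr real CARD('n))"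
    proof -
      have side: "((\<chi> i. t + h) - (\<chi> i. t)) \<bullet> e = h" if "e \<in> Basis" for e :: "real ^ 'n"
        using that by (auto simp: Basis_vec_def inner_axis)
      have "emeasure lborel ?B = ennreal (\<Prod>e\<in>Basis. ((\<chi> i. t + h) - (\<chi> i. t)) \<bullet> (e :: real ^ 'n))"
        using h by (intro emeasure_lborel_box) (auto simp: Basis_vec_def inner_axis)
      also have "\<dots> = ennreal (\<Prod>e\<in>(Basis :: (real ^ 'n) set). h)"
        using side by (simp cong: prod.cong)
      finally show ?thesis using h by (simp add: powr_realpow)
    qed
    then show ?thesis using b by (simp add: ennreal_mult)
  qed
  also have "\<dots> = (\<integral>\<^sup>+x. ennreal b * indicator ?B x \<partial>lborel)"
    by (simp add: nn_integral_cmult_indicator)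
  also have "\<dots> \<le> (\<integral>\<^sup>+x. ennreal (f x) * indicator ?B x \<partial>lborel)"
    by (intro nn_integral_mono) (auto simp: indicator_def intro!: ennreal_leI le)
  also have "\<dots> = emeasure M ?B"
    unfolding Mf using f_meas by (subst emeasure_density) auto
  also have "\<dots> \<le> emeasure M {x. t < x $ i}"
    by (intro emeasure_mono) (auto simp: mem_box_cart)
  also have "\<dots> = emeasure (margin M i) {t<..}"
    unfolding margin_def by (subst emeasure_distr) (auto simp: space vimage_def comp)
  finally have 1: "ennreal (b * h powr real CARD('n)) \<le> emeasure (margin M i) {t<..}" .
  have P: "prob_space (margin M i)" unfolding margin_def by (rule prob_space_distr) (use comp in measurable)
  interpret N: prob_space "margin M i" by (rule P)
  have "N.prob {t<..} = 1 - N.prob {..t}"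
    using N.prob_compl[of "{..t}"] by (simp add: margin_def Compl_eq_Diff_UNIV[symmetric])
  then have "N.prob {t<..} = tail M i t" by (simp add: tail_def cdf_def)
  moreover from this have "0 \<le> tail M i t" by (metis measure_nonneg)
  ultimately show ?thesis using 1 by (simp add: N.emeasure_eq_measure ennreal_le_iff)
qed

theorem proposition2p6:
  fixes M N :: "(real ^ 'n) measure"
    and f c :: "real ^ 'n \<Rightarrow> real"
    and fi :: "'n \<Rightarrow> real \<Rightarrow> real"
    and a :: "real ^ 'n"
    and first :: 'n
    and m :: "real \<Rightarrow> real"
  assumes "prob_space M" and "has_density M f"
    and "\<And>i. has_density (margin M i) (fi i)"
    and "\<And>i. continuous_on UNIV (fi i)"
    and "copula_law M N" and "has_density N c"
    and "\<And>i. 0 < a $ i" and "a $ first = 1"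
    and "\<And>i. tail_equiv (fi i) (\<lambda>t. a $ i * fi first t)"
    and "self_neglecting m"
    and "locally_uniform_limit UNIV (\<lambda>t x. m (t + m t * x) / m t) (\<lambda>x. 1) at_top"
    and "\<And>i x. tail_equiv (\<lambda>t. fi i (t + m t * x)) (\<lambda>t. fi i t * exp (- x))"
    and "\<exists>U. open U \<and> 0 \<in> U \<and> continuous_on (U \<inter> box 0 1) c"
    and "\<exists>U. open U \<and> 1 \<in> U \<and> continuous_on (U \<inter> box 0 1) c"
    and "\<And>x. f x = c (\<chi> i. cdf (margin M i) (x $ i)) * (\<Prod>i\<in>UNIV. fi i (x $ i))"
  shows
    "((\<exists>\<kappa>\<ge>1. \<exists>l. slowly_varying_at_0 l \<and> (\<exists>lamU. copula_upper_tail c \<kappa> l lamU))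
        \<longleftrightarrow> (\<exists>\<kappa>>0. \<exists>V\<in>Gamma_minus1 m. \<exists>lam. density_upper_tail f m \<kappa> V lam))
     \<and> (\<forall>\<kappa>\<ge>1. \<forall>l lamU. slowly_varying_at_0 l \<and> copula_upper_tail c \<kappa> l lamU \<longrightarrow>
          scaling (tail M first) l \<kappa> \<in> Gamma_minus1 m
          \<and> (\<exists>lam. density_upper_tail f m \<kappa> (scaling (tail M first) l \<kappa>) lam
                 \<and> tail_density_relation a lam lamU))
     \<and> (\<forall>\<kappa>>0. \<forall>V\<in>Gamma_minus1 m. \<forall>lam. density_upper_tail f m \<kappa> V lam \<longrightarrow>
          1 \<le> \<kappa>
          \<and> (\<exists>l. slowly_varying_at_0 l \<and> tail_equiv V (scaling (tail M first) l \<kappa>))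
          \<and> (\<forall>l. slowly_varying_at_0 l \<and> tail_equiv V (scaling (tail M first) l \<kappa>) \<longrightarrow>
               (\<exists>lamU. copula_upper_tail c \<kappa> l lamU \<and> tail_density_relation a lam lamU)))"
proof -
  let ?G = "tail M"
  interpret M: prob_space M by (rule assms(1))
  have margin_dist: "real_distribution (margin M i)" for i
  proof -
    have "sets M = sets borel" using assms(2) unfolding has_density_def by simp
    then have "(\<lambda>x. x $ i) \<in> measurable M borel"
      by (simp cong: measurable_cong_sets add: borel_measurable_continuous_onI continuous_on_component)
    then have "prob_space (margin M i)" unfolding margin_def by (rule M.prob_space_distr)
    then show ?thesis
      by (simp add: real_distribution_def real_distribution_axioms_def margin_def)
  qed
  interpret copula_density m ?G fi a first c f
  proof (unfold_locales)
    show "0 < m t" for t using assms(10) by (simp add: self_neglecting_def)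
    show "(?G i has_real_derivative - fi i t) (at t)" for i t
      unfolding tail_def[abs_def]
      by (auto intro!: derivative_eq_intros cdf_density_has_real_derivative[OF margin_dist assms(3,4)])
    show "(?G i \<longlongrightarrow> 0) at_top" for i
    proof -
      interpret real_distribution "margin M i" by (rule margin_dist)
      show ?thesis unfolding tail_def[abs_def] using tendsto_diff[OF tendsto_const cdf_lim_at_top_prob, of 1] by simp
    qed
    show "0 \<le> fi i t" for i t using assms(3)[of i] by (simp add: has_density_def)
    show "f x = c (\<chi> i. 1 - ?G i (x $ i)) * (\<Prod>i\<in>UNIV. fi i (x $ i))" for x
      using assms(15) by (simp add: tail_def)
  qed (fact assms)+
  have forward: "scaling (?G first) l \<kappa> \<in> Gamma_minus1 m
      \<and> (\<exists>lam. density_upper_tail f m \<kappa> (scaling (?G first) l \<kappa>) lam \<and> tail_density_relation a lam lamU)"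
    if "1 \<le> \<kappa>" "slowly_varying_at_0 l" "copula_upper_tail c \<kappa> l lamU" for \<kappa> l lamU
    using that scaling_Gamma[of \<kappa> l] copula_to_density[of \<kappa> l lamU] by simp
  have backward: "1 \<le> \<kappa>
      \<and> (\<exists>l. slowly_varying_at_0 l \<and> tail_equiv V (scaling (?G first) l \<kappa>))
      \<and> (\<forall>l. slowly_varying_at_0 l \<and> tail_equiv V (scaling (?G first) l \<kappa>) \<longrightarrow>
           (\<exists>lamU. copula_upper_tail c \<kappa> l lamU \<and> tail_density_relation a lam lamU))"
    if "0 < \<kappa>" "V \<in> Gamma_minus1 m" "density_upper_tail f m \<kappa> V lam" for \<kappa> V lam
    using exponent_ge_1[OF that cube_mass_le_tail[OF assms(1,2)]] slowly_varying_exists[OF that]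
      density_to_copula[OF that] by blast
  have "(\<exists>\<kappa>\<ge>1. \<exists>l. slowly_varying_at_0 l \<and> (\<exists>lamU. copula_upper_tail c \<kappa> l lamU))
      \<longleftrightarrow> (\<exists>\<kappa>>0. \<exists>V\<in>Gamma_minus1 m. \<exists>lam. density_upper_tail f m \<kappa> V lam)" (is "?A \<longleftrightarrow> ?B")
  proof
    assume ?A
    then obtain \<kappa> l lamU where k: "1 \<le> \<kappa>" and *: "slowly_varying_at_0 l" "copula_upper_tail c \<kappa> l lamU" by blast
    have "0 < \<kappa>" using k by simp
    then show ?B using forward[OF k *] by blast
  next
    assume ?B
    then obtain \<kappa> V lam where "0 < \<kappa>" "V \<in> Gamma_minus1 m" "density_upper_tail f m \<kappa> V lam" by blast
    then show ?A using backward by meson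
  qed
  with forward backward show ?thesis by blast
qed

end
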